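(* Let $\mathcal K$ be a monotone class of finite undirected graphs (regarded as a subcategory of $\mathbf{Gra}$, with all graph homomorphisms between its members as morphisms). Then the following three statements are equivalent: (1) There exists a subcategory $\overline{\mathcal K}$ of $\overrightarrow{\mathbf{Gra}}$, each member of which is an orientation of a member of $\mathcal K$, which embeds the category $\overrightarrow{\mathbf{Gra}}$. (2) There exists a subcategory $\overline{\mathcal K}$ of $\overrightarrow{\mathbf{Gra}}$, each member of which is an orientation of a member of $\mathcal K$, which embeds the simplicial category $\Delta$. (3) $\mathcal K$ is somewhere dense. Here the subcategories $\overline{\mathcal K}$ are full, and "$\overline{\mathcal K}$ embeds a category $\mathcal A$" means that there is a fully faithful functor $\Phi:\mathcal A\to\overline{\mathcal K}$.
   Context: All graphs are finite. $\mathbf{Gra}$ is the category of all finite undirected (simple, loopless) graphs with graph homomorphisms (adjacency-preserving vertex maps). An oriented graph is a directed graph (without loops) in which at most one arc exists between any two vertices; $\overrightarrow{\mathbf{Gra}}$ is the category of all finite oriented graphs with homomorphisms (arc-preserving vertex maps, preserving the direction of arcs). An orientation of an undirected graph $G$ is an oriented graph obtained by choosing exactly one direction for each edge of $G$. Classes of graphs are considered closed under isomorphism. A class of graphs is monotone if it is closed under taking (not necessarily induced) subgraphs. A subcategory of $\overrightarrow{\mathbf{Gra}}$ given by a class of oriented graphs is taken with all homomorphisms between its members as morphisms (a full subcategory). An embedding of a category $\mathcal A$ into such a subcategory is a functor $\Phi$ that, for any objects $A,B$ of $\mathcal A$, maps the morphisms $A\to B$ bijectively onto the homomorphisms $\Phi(A)\to\Phi(B)$.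 The simplicial category $\Delta$ has as objects the finite ordinals $[n]=\{0,1,\dots,n\}$ for integers $n\ge 0$, and as morphisms the (weakly) order-preserving maps. For an integer $p\ge 0$, the $p$-th subdivision $\mathrm{Sub}_p(G)$ of a graph $G$ is obtained by replacing each edge of $G$ by a path with exactly $p$ internal vertices (that is, of length $p+1$), the paths being internally disjoint. A class $\mathcal C$ of graphs is nowhere dense if for every integer $p\ge 0$ there exists an integer $N(p)$ such that $\mathrm{Sub}_p(K_{N(p)})$ is (isomorphic to) a subgraph of no graph in $\mathcal C$. The class $\mathcal C$ is somewhere dense if it is not nowhere dense. *)

theory Defs
  imports "HOL-Library.FuncSet" "Graph_Theory.Graph_Theory"
begin

section \<open>Categories and full embeddings\<close>

text \<open>
  Hom-sets for different pairs of objects may overlap, so composition takes the three objects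
  involved as arguments: for \<open>f \<in> Hom C X Y\<close> and \<open>g \<in> Hom C Y Z\<close>, the composite ``\<open>g\<close> after \<open>f\<close>''
  is \<open>Comp C X Y Z g f\<close>.  For the same reason the morphism part of a functor depends on
  source and target.
\<close>

record ('o, 'm) cat =
  Ob :: "'o set"
  Hom :: "'o \<Rightarrow> 'o \<Rightarrow> 'm set"
  Comp :: "'o \<Rightarrow> 'o \<Rightarrow> 'o \<Rightarrow> 'm \<Rightarrow> 'm \<Rightarrow> 'm"
  Idm :: "'o \<Rightarrow> 'm"

locale category =
  fixes C :: "('o, 'm) cat"
  assumes Idm_in_Hom: "X \<in> Ob C \<Longrightarrow> Idm C X \<in> Hom C X X"
    and Comp_in_Hom: "\<lbrakk>X \<in> Ob C; Y \<in> Ob C; Z \<in> Ob C; f \<in> Hom C X Y; g \<in> Hom C Y Z\<rbrakk>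
      \<Longrightarrow> Comp C X Y Z g f \<in> Hom C X Z"
    and Comp_Idm_right: "\<lbrakk>X \<in> Ob C; Y \<in> Ob C; f \<in> Hom C X Y\<rbrakk> \<Longrightarrow> Comp C X X Y f (Idm C X) = f"
    and Comp_Idm_left: "\<lbrakk>X \<in> Ob C; Y \<in> Ob C; f \<in> Hom C X Y\<rbrakk> \<Longrightarrow> Comp C X Y Y (Idm C Y) f = f"
    and Comp_assoc: "\<lbrakk>W \<in> Ob C; X \<in> Ob C; Y \<in> Ob C; Z \<in> Ob C;
        f \<in> Hom C W X; g \<in> Hom C X Y; h \<in> Hom C Y Z\<rbrakk>
      \<Longrightarrow> Comp C W Y Z h (Comp C W X Y g f) = Comp C W X Z (Comp C X Y Z h g) f"

definition full_subcategory :: "('o, 'm) cat \<Rightarrow> 'o set \<Rightarrow> ('o, 'm) cat" where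
  "full_subcategory C S = C\<lparr>Ob := S\<rparr>"

locale fully_faithful_functor = A: category A + B: category B
  for A :: "('o, 'm) cat" and B :: "('p, 'n) cat" +
  fixes Fo :: "'o \<Rightarrow> 'p" and Fm :: "'o \<Rightarrow> 'o \<Rightarrow> 'm \<Rightarrow> 'n"
  assumes Fo_in_Ob: "X \<in> Ob A \<Longrightarrow> Fo X \<in> Ob B"
    and Fm_Idm: "X \<in> Ob A \<Longrightarrow> Fm X X (Idm A X) = Idm B (Fo X)"
    and Fm_Comp: "\<lbrakk>X \<in> Ob A; Y \<in> Ob A; Z \<in> Ob A; f \<in> Hom A X Y; g \<in> Hom A Y Z\<rbrakk>
      \<Longrightarrow> Fm X Z (Comp A X Y Z g f) = Comp B (Fo X) (Fo Y) (Fo Z) (Fm Y Z g) (Fm X Y f)"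
    and Fm_bij: "\<lbrakk>X \<in> Ob A; Y \<in> Ob A\<rbrakk> \<Longrightarrow> bij_betw (Fm X Y) (Hom A X Y) (Hom B (Fo X) (Fo Y))"

definition embeds :: "('p, 'n) cat \<Rightarrow> ('o, 'm) cat \<Rightarrow> bool" where
  "embeds B A \<longleftrightarrow> (\<exists>Fo Fm. fully_faithful_functor A B Fo Fm)"

lemma category_full_subcategory:
  assumes "category C" "S \<subseteq> Ob C"
  shows "category (full_subcategory C S)"
proof -
  interpret category C by fact
  show ?thesis
    using assms(2)
    by unfold_locales
      (auto simp: full_subcategory_def subset_iff Comp_Idm_right Comp_Idm_left
        intro: Idm_in_Hom Comp_in_Hom Comp_assoc)
qed


section \<open>Categories of finite graphs\<close>

text \<open>
  Vertices are natural numbers; every finite graph is isomorphic to one of this kind.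
  An undirected graph is a \<^locale>\<open>pair_graph\<close>: a finite loopless digraph, each edge of which is
  present as two opposite arcs.
\<close>

type_synonym ngraph = "nat pair_pre_digraph"

definition oriented_graph :: "'a pair_pre_digraph \<Rightarrow> bool" where
  "oriented_graph D \<longleftrightarrow> pair_digraph D \<and> (\<forall>u v. (u, v) \<in> parcs D \<longrightarrow> (v, u) \<notin> parcs D)"

text \<open>
  Homomorphisms are extensional functions, so that equality of functions is equality of
  vertex maps.
\<close>

definition homs :: "'a pair_pre_digraph \<Rightarrow> 'b pair_pre_digraph \<Rightarrow> ('a \<Rightarrow> 'b) set" where
  "homs G H = {f \<in> pverts G \<rightarrow>\<^sub>E pverts H. \<forall>(u, v) \<in> parcs G. (f u, f v) \<in> parcs H}"

definition graph_category :: "'a pair_pre_digraph set \<Rightarrow> ('a pair_pre_digraph, 'a \<Rightarrow> 'a) cat" where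
  "graph_category S = \<lparr>Ob = S, Hom = homs, Comp = (\<lambda>G _ _. compose (pverts G)),
    Idm = (\<lambda>G. restrict id (pverts G))\<rparr>"

definition Gra :: "(ngraph, nat \<Rightarrow> nat) cat" where
  "Gra = graph_category {G. pair_graph G}"

definition OGra :: "(ngraph, nat \<Rightarrow> nat) cat" where
  "OGra = graph_category {D. oriented_graph D}"

definition iso_closed :: "'a pair_pre_digraph set \<Rightarrow> bool" where
  "iso_closed S \<longleftrightarrow>
    (\<forall>G \<in> S. \<forall>H :: 'a pair_pre_digraph. digraph_iso (with_proj G) (with_proj H) \<longrightarrow> H \<in> S)"

definition graph_class :: "ngraph set \<Rightarrow> bool" where
  "graph_class \<K> \<longleftrightarrow> \<K> \<subseteq> Ob Gra \<and> iso_closed \<K>"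

definition oriented_graph_class :: "ngraph set \<Rightarrow> bool" where
  "oriented_graph_class \<D> \<longleftrightarrow> \<D> \<subseteq> Ob OGra \<and> iso_closed \<D>"

definition orientation_of :: "'a pair_pre_digraph \<Rightarrow> 'a pair_pre_digraph \<Rightarrow> bool" where
  "orientation_of D G \<longleftrightarrow> pverts D = pverts G \<and> parcs D \<subseteq> parcs G \<and>
    (\<forall>(u, v) \<in> parcs G. ((u, v) \<in> parcs D) \<noteq> ((v, u) \<in> parcs D))"

definition monotone_class :: "ngraph set \<Rightarrow> bool" where
  "monotone_class \<K> \<longleftrightarrow>
    (\<forall>G \<in> \<K>. \<forall>H. pair_graph H \<and> subgraph (with_proj H) (with_proj G) \<longrightarrow> H \<in> \<K>)"

lemma category_graph_category:
  assumes "\<And>G. G \<in> S \<Longrightarrow> pair_wf_digraph G"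
  shows "category (graph_category S)"
proof
  fix X assume "X \<in> Ob (graph_category S)"
  then show "Idm (graph_category S) X \<in> Hom (graph_category S) X X"
    using pair_wf_digraph.wellformed'[OF assms, of X]
    by (auto simp: graph_category_def homs_def split_beta; force)
next
  fix X Y Z f g
  assume "X \<in> Ob (graph_category S)" and f: "f \<in> Hom (graph_category S) X Y"
    and g: "g \<in> Hom (graph_category S) Y Z"
  then have "pair_wf_digraph X" using assms by (simp add: graph_category_def)
  then interpret pair_wf_digraph X .
  show "Comp (graph_category S) X Y Z g f \<in> Hom (graph_category S) X Z"
    using f g wellformed'
    by (auto simp: graph_category_def homs_def compose_def PiE_iff; fastforce)
next
  fix X Y f assume "f \<in> Hom (graph_category S) X Y"
  then show "Comp (graph_category S) X X Y f (Idm (graph_category S) X) = f"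
    and "Comp (graph_category S) X Y Y (Idm (graph_category S) Y) f = f"
    by (auto simp: graph_category_def homs_def compose_def PiE_iff restrict_def extensional_def)
next
  fix W X Y Z f g h
  assume "f \<in> Hom (graph_category S) W X"
  then show "Comp (graph_category S) W Y Z h (Comp (graph_category S) W X Y g f)
    = Comp (graph_category S) W X Z (Comp (graph_category S) X Y Z h g) f"
    by (auto simp: graph_category_def homs_def compose_def PiE_iff)
qed

lemma category_Gra: "category Gra"
  unfolding Gra_def
  by (rule category_graph_category)
    (auto simp: pair_graph_def pair_digraph_def pair_fin_digraph_def)

lemma category_OGra: "category OGra"
  unfolding OGra_def
  by (rule category_graph_category)
    (auto simp: oriented_graph_def pair_digraph_def pair_fin_digraph_def)


section \<open>The simplicial category\<close>

text \<open>The number \<open>n\<close> stands for the ordinal \<open>[n] = {0, \<dots>, n}\<close>.\<close>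

definition Simplicial :: "(nat, nat \<Rightarrow> nat) cat" where
  "Simplicial = \<lparr>Ob = UNIV, Hom = (\<lambda>m n. {f \<in> {0..m} \<rightarrow>\<^sub>E {0..n}. mono_on {0..m} f}),
    Comp = (\<lambda>m _ _. compose {0..m}), Idm = (\<lambda>n. restrict id {0..n})\<rparr>"

lemma category_Simplicial: "category Simplicial"
proof
  fix X Y Z f g
  assume "f \<in> Hom Simplicial X Y" and "g \<in> Hom Simplicial Y Z"
  then show "Comp Simplicial X Y Z g f \<in> Hom Simplicial X Z"
    by (auto simp: Simplicial_def compose_def PiE_iff monotone_on_def)
qed (auto simp: Simplicial_def compose_def PiE_iff monotone_on_def restrict_def extensional_def)


section \<open>Subdivisions, nowhere dense and somewhere dense classes\<close>

definition complete_graph :: "nat \<Rightarrow> ngraph" where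
  "complete_graph n = \<lparr>pverts = {..<n}, parcs = {(u, v). u < n \<and> v < n \<and> u \<noteq> v}\<rparr>"

lemma complete_digraph_complete_graph: "complete_digraph n (with_proj (complete_graph n))"
  unfolding complete_digraph_pair_def by (auto simp: complete_graph_def)

text \<open>
  Each edge, written with \<open>u < v\<close>, is replaced by the path
  \<open>Branch u, Inner u v 1, \<dots>, Inner u v p, Branch v\<close>; \<open>sub_path p u v i\<close> is its \<open>i\<close>-th vertex.
\<close>

datatype 'a sub_vertex = Branch 'a | Inner 'a 'a nat

definition sub_path :: "nat \<Rightarrow> 'a \<Rightarrow> 'a \<Rightarrow> nat \<Rightarrow> 'a sub_vertex" where
  "sub_path p u v i = (if i = 0 then Branch u else if i = Suc p then Branch v else Inner u v i)"

definition Sub :: "nat \<Rightarrow> 'a::linorder pair_pre_digraph \<Rightarrow> 'a sub_vertex pair_pre_digraph" where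
  "Sub p G = \<lparr>
    pverts = Branch ` pverts G
      \<union> {Inner u v i | u v i. (u, v) \<in> parcs G \<and> u < v \<and> 1 \<le> i \<and> i \<le> p},
    parcs = (let P = {(sub_path p u v i, sub_path p u v (Suc i)) | u v i.
        (u, v) \<in> parcs G \<and> u < v \<and> i \<le> p} in P \<union> P\<inverse>)\<rparr>"

definition iso_to_subgraph :: "'a pair_pre_digraph \<Rightarrow> 'b pair_pre_digraph \<Rightarrow> bool" where
  "iso_to_subgraph H G \<longleftrightarrow> (\<exists>H' :: 'b pair_pre_digraph.
    subgraph (with_proj H') (with_proj G) \<and> digraph_iso (with_proj H) (with_proj H'))"

definition nowhere_dense :: "ngraph set \<Rightarrow> bool" where
  "nowhere_dense \<C> \<longleftrightarrow> (\<forall>p. \<exists>N. \<forall>G \<in> \<C>. \<not> iso_to_subgraph (Sub p (complete_graph N)) G)"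

definition somewhere_dense :: "ngraph set \<Rightarrow> bool" where
  "somewhere_dense \<C> \<longleftrightarrow> \<not> nowhere_dense \<C>"

end

(*
  A finite binary relation R is encoded by an oriented graph: each vertex carries a directed closed
  path of length 3l and one of length 4l, and each pair of R becomes a directed path of length 5l.
  Closed walks of lengths 3l and 4l through a common vertex force homomorphisms to map vertices of R
  to vertices of R, and since 3, 4 and 5 differ by less than 3, a walk of length 5l between two such
  vertices is one of the 5l-paths. So this is a full embedding of the category of all finite binary
  relations. The underlying graph is an (l-1)-subdivision, hence a member of any monotone class
  containing all (l-1)-subdivided complete graphs. Oriented graphs and the orders on {0, ..., n}
  are special cases.

  Conversely, an embedding of the simplicial category turns the vertex sets of the graphs Phi [n]
  into a cosimplicial set. Every x in Phi [1] has images x_ij in Phi [n] for i < j, which may depend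
  on i, on j, on both or on neither. If no path in Phi [1] that avoids the vertices of the last kind
  led from one depending on i only to one depending on j only, then the two sides could be mapped
  independently, giving a homomorphism Phi [1] -> Phi [3] that does not come from a monotone map. A
  shortest such path has images x_ij that are disjoint except for the forced coincidences, so for
  i < N <= j they form a subdivision of K_{N,N}, with a path length independent of N.
*)

theory Submission
  imports Defs "HOL-Library.Countable"
begin

section \<open>Copies of graphs\<close>

definition image_graph :: "('a \<Rightarrow> 'b) \<Rightarrow> 'a pair_pre_digraph \<Rightarrow> 'b pair_pre_digraph" where
  "image_graph f G = \<lparr>pverts = f ` pverts G, parcs = map_prod f f ` parcs G\<rparr>"

definition graph_embedding :: "'a pair_pre_digraph \<Rightarrow> 'b pair_pre_digraph \<Rightarrow> ('a \<Rightarrow> 'b) \<Rightarrow> bool" where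
  "graph_embedding H G f \<longleftrightarrow> inj_on f (pverts H) \<and> f ` pverts H \<subseteq> pverts G \<and>
    (\<forall>(u, v) \<in> parcs H. (f u, f v) \<in> parcs G)"

lemma pair_wf_digraph_iff:
  "pair_wf_digraph G \<longleftrightarrow> (\<forall>(u, v) \<in> parcs G. u \<in> pverts G \<and> v \<in> pverts G)"
  unfolding pair_wf_digraph_def by auto

lemma pair_digraph_iff:
  "pair_digraph G \<longleftrightarrow> finite (pverts G) \<and> (\<forall>(u, v) \<in> parcs G. u \<in> pverts G \<and> v \<in> pverts G \<and> u \<noteq> v)"
proof -
  have "finite (parcs G)" if "finite (pverts G)" "\<forall>(u, v) \<in> parcs G. u \<in> pverts G \<and> v \<in> pverts G"
    by (rule finite_subset[of _ "pverts G \<times> pverts G"]) (use that in auto)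
  then show ?thesis
    unfolding pair_digraph_def pair_fin_digraph_def pair_loopfree_digraph_def pair_wf_digraph_iff
      pair_fin_digraph_axioms_def pair_loopfree_digraph_axioms_def
    by auto
qed

lemma pair_graph_iff: "pair_graph G \<longleftrightarrow> pair_digraph G \<and> sym (parcs G)"
  unfolding pair_graph_def pair_pseudo_graph_def pair_digraph_def pair_sym_digraph_def
    pair_sym_digraph_axioms_def pair_fin_digraph_def symmetric_def
  by auto

text \<open>An isomorphism here is a record with separate maps for vertices, arcs, tails and heads.
  Arcs that are pairs are moved by the vertex map alone, so an injective vertex map carries all the
  information.\<close>

lemma digraph_iso_iff:
  assumes "pair_wf_digraph G"
  shows "digraph_iso (with_proj G) (with_proj H) \<longleftrightarrow>
    (\<exists>f. inj_on f (pverts G) \<and> H = image_graph f G)"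
proof
  assume "digraph_iso (with_proj G) (with_proj H)"
  then obtain i where i: "pre_digraph.digraph_isomorphism (with_proj G) i"
    and H: "with_proj H = app_iso i (with_proj G)"
    unfolding digraph_iso_def by auto
  have "iso_tail i = fst" "iso_head i = snd" "pverts H = iso_verts i ` pverts G"
    "parcs H = iso_arcs i ` parcs G"
    using H by (simp_all add: with_proj_def app_iso_def)
  moreover have "iso_arcs i a = map_prod (iso_verts i) (iso_verts i) a" if "a \<in> parcs G" for a
    using i that \<open>iso_tail i = fst\<close> \<open>iso_head i = snd\<close>
    by (auto simp: pre_digraph.digraph_isomorphism_def intro!: prod_eqI)
  ultimately have "H = image_graph (iso_verts i) G"
    unfolding image_graph_def by (intro pair_pre_digraph.equality) auto
  moreover have "inj_on (iso_verts i) (pverts G)"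
    using i by (auto simp: pre_digraph.digraph_isomorphism_def)
  ultimately show "\<exists>f. inj_on f (pverts G) \<and> H = image_graph f G" by blast
next
  assume "\<exists>f. inj_on f (pverts G) \<and> H = image_graph f G"
  then obtain f where f: "inj_on f (pverts G)" and H: "H = image_graph f G" by blast
  have "parcs G \<subseteq> pverts G \<times> pverts G"
    using assms by (auto simp: pair_wf_digraph_iff)
  then have inj: "inj_on (map_prod f f) (parcs G)"
    by (rule inj_on_subset[OF map_prod_inj_on[OF f f]])
  let ?i = "\<lparr>iso_verts = f, iso_arcs = map_prod f f, iso_head = snd, iso_tail = fst\<rparr>"
  have "wf_digraph (with_proj G)" using assms by (simp add: wf_digraph_wp_iff)
  then have "pre_digraph.digraph_isomorphism (with_proj G) ?i"
    using f inj by (auto simp: pre_digraph.digraph_isomorphism_def)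
  moreover have "with_proj H = app_iso ?i (with_proj G)"
    by (simp add: H image_graph_def with_proj_def app_iso_def)
  ultimately show "digraph_iso (with_proj G) (with_proj H)"
    unfolding digraph_iso_def by blast
qed

lemma subgraph_with_proj_iff:
  "subgraph (with_proj H) (with_proj G) \<longleftrightarrow>
    pverts H \<subseteq> pverts G \<and> parcs H \<subseteq> parcs G \<and> pair_wf_digraph G \<and> pair_wf_digraph H"
  by (auto simp: subgraph_def wf_digraph_wp_iff)

lemma graph_embedding_imp_subgraph:
  assumes "pair_wf_digraph H" "pair_wf_digraph G" "graph_embedding H G f"
  shows "subgraph (with_proj (image_graph f H)) (with_proj G)"
  using assms by (auto simp: subgraph_with_proj_iff pair_wf_digraph_iff graph_embedding_def image_graph_def)

lemma iso_to_subgraph_iff: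
  assumes "pair_wf_digraph H" "pair_wf_digraph G"
  shows "iso_to_subgraph H G \<longleftrightarrow> (\<exists>f. graph_embedding H G f)"
proof
  assume "iso_to_subgraph H G"
  then obtain f where "inj_on f (pverts H)" "subgraph (with_proj (image_graph f H)) (with_proj G)"
    unfolding iso_to_subgraph_def digraph_iso_iff[OF assms(1)] by blast
  then have "graph_embedding H G f"
    by (auto simp: graph_embedding_def subgraph_with_proj_iff image_graph_def)
  then show "\<exists>f. graph_embedding H G f" by blast
next
  assume "\<exists>f. graph_embedding H G f"
  then obtain f where f: "graph_embedding H G f" by blast
  then have "inj_on f (pverts H)" by (simp add: graph_embedding_def)
  with graph_embedding_imp_subgraph[OF assms f] show "iso_to_subgraph H G"
    unfolding iso_to_subgraph_def digraph_iso_iff[OF assms(1)] by blast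
qed

lemma image_graph_inverse:
  assumes "pair_wf_digraph G" "inj_on f (pverts G)"
  shows "image_graph (inv_into (pverts G) f) (image_graph f G) = G"
proof -
  have "map_prod (inv_into (pverts G) f) (inv_into (pverts G) f) ` map_prod f f ` parcs G
    = (\<lambda>a. a) ` parcs G"
    unfolding image_image using assms by (intro image_cong) (auto simp: pair_wf_digraph_iff)
  then show ?thesis using assms(2) by (simp add: image_graph_def)
qed

lemma pair_digraph_image_graph:
  assumes "pair_digraph G" "inj_on f (pverts G)"
  shows "pair_digraph (image_graph f G)"
proof -
  have "f u \<in> f ` pverts G \<and> f v \<in> f ` pverts G \<and> f v \<noteq> f u" if "(u, v) \<in> parcs G" for u v
    using assms(1) that by (auto simp: pair_digraph_iff inj_on_eq_iff[OF assms(2)])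
  moreover have "finite (f ` pverts G)" using assms(1) by (simp add: pair_digraph_iff)
  ultimately show ?thesis by (fastforce simp: pair_digraph_iff image_graph_def)
qed

lemma pair_graph_image_graph:
  assumes "pair_graph G" "inj_on f (pverts G)"
  shows "pair_graph (image_graph f G)"
proof -
  have "pair_digraph (image_graph f G)"
    using assms by (simp add: pair_graph_iff pair_digraph_image_graph)
  moreover have "sym (parcs (image_graph f G))"
    using assms(1) by (auto simp: pair_graph_iff image_graph_def sym_def)
  ultimately show ?thesis by (simp add: pair_graph_iff)
qed

lemma pair_graph_imp_wf: "pair_graph G \<Longrightarrow> pair_wf_digraph G"
  by (auto simp: pair_graph_iff pair_digraph_iff pair_wf_digraph_iff)

text \<open>The image of \<open>H\<close> under \<open>f\<close> is a subgraph of \<open>G\<close>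
  and isomorphic to \<open>H\<close>, so closure under subgraphs and closure under isomorphism
  combine.\<close>

lemma monotone_class_embedding:
  assumes "graph_class \<K>" "monotone_class \<K>" "G \<in> \<K>" "pair_graph H" "graph_embedding H G f"
  shows "H \<in> \<K>"
proof -
  have inj: "inj_on f (pverts H)" using assms(5) by (simp add: graph_embedding_def)
  have "pair_wf_digraph G"
    using assms(1,3) by (auto simp: graph_class_def Gra_def graph_category_def pair_graph_imp_wf)
  then have "image_graph f H \<in> \<K>"
    using assms(2-5) graph_embedding_imp_subgraph[of H G f] pair_graph_image_graph[OF assms(4) inj]
    by (auto simp: monotone_class_def pair_graph_imp_wf)
  moreover have "digraph_iso (with_proj (image_graph f H)) (with_proj H)"
    unfolding digraph_iso_iff[OF pair_graph_imp_wf[OF pair_graph_image_graph[OF assms(4) inj]]]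
    using image_graph_inverse[OF pair_graph_imp_wf[OF assms(4)] inj]
    by (intro exI[of _ "inv_into (pverts H) f"])
      (auto simp: image_graph_def intro: inj_on_inv_into)
  ultimately show ?thesis using assms(1) unfolding graph_class_def iso_closed_def by blast
qed

section \<open>Underlying graphs and orientations\<close>

definition underlying_graph :: "'a pair_pre_digraph \<Rightarrow> 'a pair_pre_digraph" where
  "underlying_graph D = \<lparr>pverts = pverts D, parcs = parcs D \<union> (parcs D)\<inverse>\<rparr>"

lemma underlying_graph_simps [simp]:
  "pverts (underlying_graph D) = pverts D"
  "parcs (underlying_graph D) = parcs D \<union> (parcs D)\<inverse>"
  by (simp_all add: underlying_graph_def)

lemma pair_graph_underlying_graph: "pair_digraph D \<Longrightarrow> pair_graph (underlying_graph D)"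
  by (auto simp: pair_graph_iff pair_digraph_iff sym_def)

lemma orientation_of_underlying_graph:
  "oriented_graph D \<Longrightarrow> orientation_of D (underlying_graph D)"
  by (auto simp: orientation_of_def oriented_graph_def)

lemma orientation_of_imp_underlying_graph:
  assumes "orientation_of D G" "pair_graph G"
  shows "underlying_graph D = G"
proof (rule pair_pre_digraph.equality)
  have "(v, u) \<in> parcs G" if "(u, v) \<in> parcs G" for u v
    using assms(2) that by (auto simp: pair_graph_iff sym_def)
  then show "parcs (underlying_graph D) = parcs G"
    using assms(1) by (auto simp: orientation_of_def)
qed (use assms(1) in \<open>simp_all add: orientation_of_def\<close>)

text \<open>For a graph class \<open>\<K>\<close> this is the largest class admissible in the
  theorem, since an orientation of a member has that member as its underlying graph.\<close>

definition orientations :: "ngraph set \<Rightarrow> ngraph set" where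
  "orientations \<K> = {D. oriented_graph D \<and> underlying_graph D \<in> \<K>}"

lemma oriented_graph_class_orientations:
  assumes "graph_class \<K>"
  shows "oriented_graph_class (orientations \<K>)"
proof -
  have "H \<in> orientations \<K>"
    if D: "D \<in> orientations \<K>" and iso: "digraph_iso (with_proj D) (with_proj H)" for D H :: ngraph
  proof -
    have wf: "pair_digraph D" and arcs: "\<And>u v. (u, v) \<in> parcs D \<Longrightarrow> (v, u) \<notin> parcs D"
      and "underlying_graph D \<in> \<K>"
      using D by (auto simp: orientations_def oriented_graph_def)
    then have "pair_wf_digraph D" by (auto simp: pair_digraph_iff pair_wf_digraph_iff)
    then obtain f where f: "inj_on f (pverts D)" and H: "H = image_graph f D"
      using iso digraph_iso_iff by blast
    have "underlying_graph H = image_graph f (underlying_graph D)"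
      by (auto simp: H image_graph_def underlying_graph_def)
    moreover have "pair_wf_digraph (underlying_graph D)"
      using wf by (simp add: pair_graph_imp_wf pair_graph_underlying_graph)
    ultimately have "digraph_iso (with_proj (underlying_graph D)) (with_proj (underlying_graph H))"
      using f by (auto simp: digraph_iso_iff)
    then have "underlying_graph H \<in> \<K>"
      using assms \<open>underlying_graph D \<in> \<K>\<close> unfolding graph_class_def iso_closed_def by blast
    moreover have "pair_digraph H"
      using wf f by (simp add: H pair_digraph_image_graph)
    moreover have "(v, u) \<notin> parcs H" if "(u, v) \<in> parcs H" for u v
    proof
      assume "(v, u) \<in> parcs H"
      with that obtain a b c d where "(a, b) \<in> parcs D" "(c, d) \<in> parcs D"
        "f a = f d" "f b = f c"
        by (auto simp: H image_graph_def)
      moreover from this have "{a, b, c, d} \<subseteq> pverts D"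
        using \<open>pair_wf_digraph D\<close> by (auto simp: pair_wf_digraph_iff)
      ultimately have "(b, a) \<in> parcs D" by (simp add: inj_on_eq_iff[OF f])
      with arcs \<open>(a, b) \<in> parcs D\<close> show False by blast
    qed
    ultimately show ?thesis by (auto simp: orientations_def oriented_graph_def)
  qed
  then have "iso_closed (orientations \<K>)" unfolding iso_closed_def by blast
  moreover have "orientations \<K> \<subseteq> Ob OGra"
    by (auto simp: OGra_def graph_category_def orientations_def)
  ultimately show ?thesis by (simp add: oriented_graph_class_def)
qed

section \<open>Encoding binary relations by oriented graphs\<close>

lemma homs_vert: "f \<in> homs G H \<Longrightarrow> u \<in> pverts G \<Longrightarrow> f u \<in> pverts H"
  by (auto simp: homs_def)

lemma homs_arc: "f \<in> homs G H \<Longrightarrow> (u, v) \<in> parcs G \<Longrightarrow> (f u, f v) \<in> parcs H"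
  by (auto simp: homs_def)

lemma homs_outside: "f \<in> homs G H \<Longrightarrow> u \<notin> pverts G \<Longrightarrow> f u = undefined"
  by (auto simp: homs_def PiE_iff extensional_def)

lemma restrict_homsI:
  assumes "pair_wf_digraph G" "\<And>u. u \<in> pverts G \<Longrightarrow> f u \<in> pverts H"
    and "\<And>u v. (u, v) \<in> parcs G \<Longrightarrow> (f u, f v) \<in> parcs H"
  shows "restrict f (pverts G) \<in> homs G H"
  using assms by (auto simp: homs_def pair_wf_digraph_iff)

text \<open>Vertices of an \<open>ngraph\<close> must be natural numbers. Encoding a sum type keeps
  the vertices of a relation apart from the inner vertices of paths and lets \<open>path_map\<close>
  decode both.\<close>

definition hub :: "nat \<Rightarrow> nat" where
  "hub u = to_nat (Inl u :: nat + (nat \<times> nat \<times> nat) \<times> nat)"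

definition inner :: "nat \<times> nat \<times> nat \<Rightarrow> nat \<Rightarrow> nat" where
  "inner e i = to_nat (Inr (e, i) :: nat + (nat \<times> nat \<times> nat) \<times> nat)"

lemma hub_inner_simps [simp]:
  "hub u = hub v \<longleftrightarrow> u = v" "inner e i = inner e' j \<longleftrightarrow> e = e' \<and> i = j"
  "hub u \<noteq> inner e i" "inner e i \<noteq> hub u"
  by (simp_all add: hub_def inner_def)

text \<open>A triple \<open>(k, u, v)\<close> stands for a directed path of length \<open>k * l\<close> from \<open>u\<close> to \<open>v\<close>.\<close>

definition path_pos :: "nat \<Rightarrow> nat \<times> nat \<times> nat \<Rightarrow> nat \<Rightarrow> nat" where
  "path_pos l e i = (if i = 0 then hub (fst (snd e))
    else if i = fst e * l then hub (snd (snd e)) else inner e i)"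

text \<open>The tag 5 keeps a loop of \<open>R\<close> distinct from the closed paths with tags 3
  and 4 that every vertex carries.\<close>

definition path_triples :: "ngraph \<Rightarrow> (nat \<times> nat \<times> nat) set" where
  "path_triples R = (\<lambda>u. (3, u, u)) ` pverts R \<union> (\<lambda>u. (4, u, u)) ` pverts R \<union> Pair 5 ` parcs R"

definition path_graph :: "nat \<Rightarrow> ngraph \<Rightarrow> ngraph" where
  "path_graph l R = \<lparr>
    pverts = {path_pos l e i | e i. e \<in> path_triples R \<and> i \<le> fst e * l},
    parcs = {(path_pos l e i, path_pos l e (Suc i)) | e i. e \<in> path_triples R \<and> i < fst e * l}\<rparr>"

lemma fst_path_triples: "e \<in> path_triples R \<Longrightarrow> fst e \<in> {3, 4, 5}"
  by (auto simp: path_triples_def)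

lemma path_triples_iff [simp]:
  "(3, u, v) \<in> path_triples R \<longleftrightarrow> u \<in> pverts R \<and> v = u"
  "(4, u, v) \<in> path_triples R \<longleftrightarrow> u \<in> pverts R \<and> v = u"
  "(5, u, v) \<in> path_triples R \<longleftrightarrow> (u, v) \<in> parcs R"
  by (auto simp: path_triples_def)

lemma path_triples_verts:
  assumes "pair_wf_digraph R" "(k, u, v) \<in> path_triples R"
  shows "u \<in> pverts R" "v \<in> pverts R"
  using assms by (auto simp: path_triples_def pair_wf_digraph_iff)

lemma finite_path_triples:
  assumes "pair_wf_digraph R" "finite (pverts R)"
  shows "finite (path_triples R)"
proof -
  have "finite (parcs R)"
    by (rule finite_subset[of _ "pverts R \<times> pverts R"])
      (use assms in \<open>auto simp: pair_wf_digraph_iff\<close>)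
  then show ?thesis using assms(2) by (simp add: path_triples_def)
qed

lemma path_pos_0 [simp]: "path_pos l e 0 = hub (fst (snd e))"
  by (simp add: path_pos_def)

lemma path_pos_inner: "0 < i \<Longrightarrow> i < fst e * l \<Longrightarrow> path_pos l e i = inner e i"
  by (simp add: path_pos_def)

lemma path_pos_inner_eqD:
  assumes "path_pos l e i = path_pos l e' j" "0 < i" "i < fst e * l"
  shows "e' = e" "j = i"
  using assms by (auto simp: path_pos_def split: if_splits)

lemma path_graph_vertI:
  "e \<in> path_triples R \<Longrightarrow> i \<le> fst e * l \<Longrightarrow> path_pos l e i \<in> pverts (path_graph l R)"
  by (auto simp: path_graph_def simp del: split_paired_Ex)

lemma path_graph_arcI:
  "e \<in> path_triples R \<Longrightarrow> i < fst e * l \<Longrightarrow> (path_pos l e i, path_pos l e (Suc i)) \<in> parcs (path_graph l R)"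
  by (auto simp: path_graph_def simp del: split_paired_Ex)

lemma path_graph_hubI: "u \<in> pverts R \<Longrightarrow> hub u \<in> pverts (path_graph l R)"
  using path_graph_vertI[of "(3, u, u)" R 0] by simp

lemma path_graph_arcD:
  assumes "(x, y) \<in> parcs (path_graph l R)"
  obtains e i where "e \<in> path_triples R" "i < fst e * l" "x = path_pos l e i" "y = path_pos l e (Suc i)"
  using assms by (auto simp: path_graph_def)

lemma pair_wf_digraph_path_graph: "pair_wf_digraph (path_graph l R)"
  unfolding pair_wf_digraph_iff
  by (clarsimp elim!: path_graph_arcD simp del: split_paired_Ex) (simp add: path_graph_vertI)

section \<open>Walks in path graphs\<close>

lemma path_graph_succ:
  assumes "(path_pos l e i, y) \<in> parcs (path_graph l R)" "0 < i" "i < fst e * l"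
  shows "y = path_pos l e (Suc i)"
proof -
  obtain e' j where e': "path_pos l e i = path_pos l e' j" "y = path_pos l e' (Suc j)"
    using assms(1) by (rule path_graph_arcD)
  with path_pos_inner_eqD[OF e'(1) assms(2,3)] show ?thesis by simp
qed

lemma path_graph_pred:
  assumes "(x, path_pos l e (Suc i)) \<in> parcs (path_graph l R)" "Suc i < fst e * l"
  shows "x = path_pos l e i"
proof -
  obtain e' j where e': "x = path_pos l e' j" "path_pos l e (Suc i) = path_pos l e' (Suc j)"
    using assms(1) by (rule path_graph_arcD)
  with path_pos_inner_eqD[OF e'(2) _ assms(2)] show ?thesis by simp
qed

text \<open>The code of an inner vertex names its path and its position, so it has just one
  successor and one predecessor. A hub leaves a choice; hence \<open>0 < i\<close>, while
  \<open>i + d\<close> may be the final hub. \<open>walk_backward\<close> mirrors this.\<close>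

lemma walk_forward:
  assumes "\<forall>t < n. (w t, w (Suc t)) \<in> parcs (path_graph l R)"
    and "w s = path_pos l e i" "0 < i" "i + d \<le> fst e * l" "s + d \<le> n"
  shows "w (s + d) = path_pos l e (i + d)"
  using assms(4,5)
proof (induction d)
  case (Suc d)
  then show ?case using assms(1)[rule_format, of "s + d"] path_graph_succ[of l e "i + d"] assms(3) by simp
qed (simp add: assms(2))

lemma walk_backward:
  assumes "\<forall>t < n. (w t, w (Suc t)) \<in> parcs (path_graph l R)"
    and "w s = path_pos l e i" "i < fst e * l" "d \<le> i" "d \<le> s" "s \<le> n"
  shows "w (s - d) = path_pos l e (i - d)"
  using assms(4,5)
proof (induction d)
  case (Suc d)
  then show ?case
    using assms(1)[rule_format, of "s - Suc d"] path_graph_pred[of "w (s - Suc d)" l e "i - Suc d" R]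
      assms(3,6)
    by (simp add: Suc_diff_Suc)
qed (simp add: assms(2))

context
  fixes l :: nat
  assumes l_pos: "0 < l"
begin

lemma path_pos_end [simp]: "0 < fst e \<Longrightarrow> path_pos l e (fst e * l) = hub (snd (snd e))"
  using l_pos by (auto simp: path_pos_def)

lemma path_triples_length:
  assumes "e \<in> path_triples R"
  shows "3 * l \<le> fst e * l" "2 < fst e * l" "fst e * l \<le> 5 * l"
proof -
  show "3 * l \<le> fst e * l" "fst e * l \<le> 5 * l" using fst_path_triples[OF assms] by auto
  then show "2 < fst e * l" using l_pos by linarith
qed

lemma path_graph_hub_succ:
  assumes "(hub x, y) \<in> parcs (path_graph l R)"
  obtains k v where "(k, x, v) \<in> path_triples R" "y = path_pos l (k, x, v) 1"
proof -
  obtain e i where e: "e \<in> path_triples R" "i < fst e * l" "hub x = path_pos l e i"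
    "y = path_pos l e (Suc i)"
    using assms by (rule path_graph_arcD)
  then have "i = 0" using path_pos_inner[of i e l] by (cases "i = 0") simp_all
  with e show thesis by (cases e) (auto intro: that)
qed

text \<open>The first arc chooses a path, and from then on the walk is forced up to the end of that
  path. It cannot stop earlier, because the positions in between are inner vertices.\<close>

lemma walk_between_hubs_start:
  assumes walk: "\<forall>t < n. (w t, w (Suc t)) \<in> parcs (path_graph l R)"
    and ends: "w 0 = hub x" "w n = hub y" and "0 < n"
  obtains k v where "(k, x, v) \<in> path_triples R" "k * l \<le> n"
    "\<And>t. t \<le> k * l \<Longrightarrow> w t = path_pos l (k, x, v) t"
proof -
  have "(hub x, w 1) \<in> parcs (path_graph l R)" using walk[rule_format, of 0] ends \<open>0 < n\<close> by simp
  then obtain k v where kv: "(k, x, v) \<in> path_triples R" and w1: "w 1 = path_pos l (k, x, v) 1"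
    by (rule path_graph_hub_succ)
  have len: "2 < k * l" using path_triples_length(2)[OF kv] by simp
  have w: "w t = path_pos l (k, x, v) t" if "t \<le> k * l" "t \<le> n" for t
    using walk_forward[OF walk w1, of "t - 1"] that ends(1) by (cases "t = 0") (auto simp: path_pos_def)
  have "k * l \<le> n"
  proof (rule ccontr)
    assume "\<not> k * l \<le> n"
    then have "w n = inner (k, x, v) n" using w[of n] \<open>0 < n\<close> by (simp add: path_pos_inner)
    with ends(2) show False by simp
  qed
  then show thesis using that[OF kv] w by simp
qed

lemma walk_between_hubs_length:
  assumes "\<forall>t < n. (w t, w (Suc t)) \<in> parcs (path_graph l R)"
    and "w 0 = hub x" "w n = hub y" "0 < n"
  shows "3 * l \<le> n"
proof -
  obtain k v where "(k, x, v) \<in> path_triples R" "k * l \<le> n"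
    using assms by (rule walk_between_hubs_start[of n w R x y]) blast+
  moreover from this have "3 * l \<le> k * l" using path_triples_length(1)[of "(k, x, v)" R] by simp
  ultimately show ?thesis by linarith
qed

text \<open>If the first path traversed had a smaller tag, the rest would be a walk between hubs of
  length at most \<open>2 * l\<close>, below the minimum \<open>3 * l\<close>.\<close>

lemma walk_between_hubs:
  assumes walk: "\<forall>t < k * l. (w t, w (Suc t)) \<in> parcs (path_graph l R)"
    and ends: "w 0 = hub x" "w (k * l) = hub y" and k: "k \<in> {3, 4, 5}"
  shows "(k, x, y) \<in> path_triples R" "t \<le> k * l \<Longrightarrow> w t = path_pos l (k, x, y) t"
proof -
  have "0 < k * l" using k l_pos by auto
  with walk ends obtain k' v where kv: "(k', x, v) \<in> path_triples R" and le: "k' * l \<le> k * l"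
    and w: "\<And>t. t \<le> k' * l \<Longrightarrow> w t = path_pos l (k', x, v) t"
    by (rule walk_between_hubs_start[of "k * l" w R x y]) blast+
  have k': "k' \<in> {3, 4, 5}" using fst_path_triples[OF kv] by simp
  then have hub: "w (k' * l) = hub v" using w[of "k' * l"] path_pos_end[of "(k', x, v)"] by auto
  have eq: "k' = k"
  proof (rule ccontr)
    assume "k' \<noteq> k"
    then have "k' < k" using le l_pos by auto
    then have "0 < (k - k') * l" using l_pos by simp
    moreover have "(w (k' * l + t), w (Suc (k' * l + t))) \<in> parcs (path_graph l R)"
      if "t < (k - k') * l" for t
      using walk[rule_format, of "k' * l + t"] that by (simp add: diff_mult_distrib)
    moreover have "w (k' * l + (k - k') * l) = hub y"
      using le ends(2) by (simp add: diff_mult_distrib)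
    ultimately have "3 * l \<le> (k - k') * l"
      using walk_between_hubs_length[of "(k - k') * l" "\<lambda>t. w (k' * l + t)" R v y] hub by simp
    with l_pos k k' \<open>k' < k\<close> show False by auto
  qed
  with hub ends(2) have "v = y" by simp
  with kv w eq show "(k, x, y) \<in> path_triples R" "t \<le> k * l \<Longrightarrow> w t = path_pos l (k, x, y) t"
    by auto
qed

text \<open>
  A vertex with closed walks of lengths \<open>3 * l\<close> and \<open>4 * l\<close> through it is a hub: an inner vertex
  of a path from \<open>x\<close> to \<open>y\<close> would make the first walk traverse a whole loop at \<open>x = y\<close>, and
  then the second one would contain a walk of length \<open>l\<close> from \<open>y\<close> to \<open>x\<close>.
\<close>

lemma closed_walks_imp_hub:
  assumes walk3: "\<forall>t < 3 * l. (w t, w (Suc t)) \<in> parcs (path_graph l R)"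
    and ends3: "w 0 = z" "w (3 * l) = z"
    and walk4: "\<forall>t < 4 * l. (w' t, w' (Suc t)) \<in> parcs (path_graph l R)"
    and ends4: "w' 0 = z" "w' (4 * l) = z"
    and wf: "pair_wf_digraph R" and z: "z \<in> pverts (path_graph l R)"
  shows "\<exists>x \<in> pverts R. z = hub x"
proof -
  obtain k x y i where e: "(k, x, y) \<in> path_triples R" "i \<le> k * l"
    and z: "z = path_pos l (k, x, y) i"
    using z by (auto simp: path_graph_def)
  have k: "k \<in> {3, 4, 5}" using fst_path_triples[OF e(1)] by simp
  have xy: "x \<in> pverts R" "y \<in> pverts R" using path_triples_verts[OF wf e(1)] by auto
  have end_pos: "path_pos l (k, x, y) (k * l) = hub y"
    using path_pos_end[of "(k, x, y)"] k by auto
  show ?thesis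
  proof (cases "0 < i \<and> i < k * l")
    case False
    then have "i = 0 \<or> i = k * l" using e(2) by linarith
    then have "z = hub x \<or> z = hub y" using z end_pos by (elim disjE) simp_all
    with xy show ?thesis by blast
  next
    case True
    then have i: "0 < i" "i < k * l" by simp_all
    then have inner: "z = inner (k, x, y) i" using z by (simp add: path_pos_inner)
    \<comment> \<open>Otherwise the walk, followed backwards from \<open>z\<close> for all its
      \<open>3 * l\<close> steps, never leaves the path and starts at a smaller position than
      \<open>i\<close>.\<close>
    have i3: "i \<le> 3 * l"
    proof (rule ccontr)
      assume "\<not> i \<le> 3 * l"
      then have "w (3 * l - 3 * l) = path_pos l (k, x, y) (i - 3 * l)"
        using walk_backward[OF walk3, of "3 * l" "(k, x, y)" i "3 * l"] i ends3(2) z by simp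
      moreover have "path_pos l (k, x, y) (i - 3 * l) = inner (k, x, y) (i - 3 * l)"
        using \<open>\<not> i \<le> 3 * l\<close> i by (intro path_pos_inner) auto
      ultimately have "i = i - 3 * l" using ends3(1) inner by simp
      then show False using i l_pos by linarith
    qed
    have w3: "w (3 * l - i) = hub x"
      using walk_backward[OF walk3, of "3 * l" "(k, x, y)" i i] i i3 ends3(2) z by simp
    \<comment> \<open>On a longer path, going forward from \<open>z\<close> would reach position
      \<open>3 * l\<close>, an inner vertex, at the very time when the walk is at
      \<open>hub x\<close> by \<open>w3\<close>.\<close>
    have "k = 3"
    proof (rule ccontr)
      assume "k \<noteq> 3"
      then have k3: "3 * l < k * l" using k l_pos by auto
      then have "w (0 + (3 * l - i)) = path_pos l (k, x, y) (i + (3 * l - i))"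
        using ends3(1) z i i3 by (intro walk_forward[OF walk3]) simp_all
      moreover have "path_pos l (k, x, y) (3 * l) = inner (k, x, y) (3 * l)"
        using k3 l_pos by (intro path_pos_inner) simp_all
      ultimately show False using w3 i3 by simp
    qed
    have "w' (0 + (3 * l - i)) = path_pos l (k, x, y) (i + (3 * l - i))"
      using ends4(1) z i i3 \<open>k = 3\<close> by (intro walk_forward[OF walk4]) simp_all
    then have start: "w' (3 * l - i) = hub y" using i3 end_pos \<open>k = 3\<close> by simp
    have "w' (4 * l - i) = hub x"
      using walk_backward[OF walk4, of "4 * l" "(k, x, y)" i i] i i3 ends4(2) z by simp
    moreover have "4 * l - i = 3 * l - i + l" using i3 by simp
    ultimately have stop: "w' (3 * l - i + l) = hub x" by simp
    have "\<forall>t < l. (w' (3 * l - i + t), w' (3 * l - i + Suc t)) \<in> parcs (path_graph l R)"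
      using walk4 i i3 by simp
    then have "3 * l \<le> l"
      using walk_between_hubs_length[of l "\<lambda>t. w' (3 * l - i + t)" R y x] start stop l_pos by simp
    with l_pos show ?thesis by simp
  qed
qed

end

lemma path_graph_vert_cases:
  assumes "z \<in> pverts (path_graph l R)"
  obtains k u v i where "(k, u, v) \<in> path_triples R" "i \<le> k * l" "z = path_pos l (k, u, v) i"
  using assms by (auto simp: path_graph_def)

section \<open>The encoding on homomorphisms\<close>

definition path_map :: "(nat \<Rightarrow> nat) \<Rightarrow> nat \<Rightarrow> nat" where
  "path_map f z = (case (from_nat z :: nat + (nat \<times> nat \<times> nat) \<times> nat) of
    Inl u \<Rightarrow> hub (f u) | Inr (e, i) \<Rightarrow> inner (map_prod id (map_prod f f) e) i)"

lemma path_map_hub [simp]: "path_map f (hub u) = hub (f u)"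
  by (simp add: path_map_def hub_def)

lemma path_map_path_pos [simp]:
  "path_map f (path_pos l (k, u, v) i) = path_pos l (k, f u, f v) i"
  by (simp add: path_map_def path_pos_def hub_def inner_def)

lemma path_triples_hom:
  assumes "f \<in> homs R R'" "pair_wf_digraph R" "(k, u, v) \<in> path_triples R"
  shows "(k, f u, f v) \<in> path_triples R'"
proof -
  have "k \<in> {3, 4, 5}" using fst_path_triples[OF assms(3)] by simp
  then show ?thesis
    using assms(3) homs_vert[OF assms(1), of u] homs_arc[OF assms(1), of u v] by auto
qed

context
  fixes l :: nat
  assumes l_pos: "0 < l"
begin

lemma path_map_hom:
  assumes "f \<in> homs R R'" "pair_wf_digraph R"
  shows "restrict (path_map f) (pverts (path_graph l R)) \<in> homs (path_graph l R) (path_graph l R')"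
proof -
  have V: "path_map f z \<in> pverts (path_graph l R')" if z: "z \<in> pverts (path_graph l R)" for z
  proof -
    obtain k u v i where "(k, u, v) \<in> path_triples R" "i \<le> k * l" "z = path_pos l (k, u, v) i"
      using z by (rule path_graph_vert_cases)
    then show ?thesis
      using path_graph_vertI[OF path_triples_hom[OF assms], of k u v i] by simp
  qed
  have "(path_map f x, path_map f y) \<in> parcs (path_graph l R')"
    if xy: "(x, y) \<in> parcs (path_graph l R)" for x y
  proof -
    obtain e i where e: "e \<in> path_triples R" "i < fst e * l" "x = path_pos l e i" "y = path_pos l e (Suc i)"
      using path_graph_arcD[OF xy] .
    obtain k u v where "e = (k, u, v)" by (cases e)
    with e show ?thesis
      using path_graph_arcI[OF path_triples_hom[OF assms], of k u v i] by simp
  qed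
  with V show ?thesis by (intro restrict_homsI[OF pair_wf_digraph_path_graph])
qed

text \<open>Fullness of the encoding: the closed paths at a hub go to closed walks of lengths
  \<open>3 * l\<close> and \<open>4 * l\<close>, so hubs go to hubs. Each path then becomes a walk
  of its own length between hubs, hence a path with the same tag.\<close>

lemma path_graph_hom_imp_path_map:
  assumes h: "h \<in> homs (path_graph l R) (path_graph l R')"
    and wf: "pair_wf_digraph R" "pair_wf_digraph R'"
  obtains f where "f \<in> homs R R'" "h = restrict (path_map f) (pverts (path_graph l R))"
proof -
  have walk: "(h (path_pos l e t), h (path_pos l e (Suc t))) \<in> parcs (path_graph l R')"
    if "e \<in> path_triples R" "t < fst e * l" for e t
    using homs_arc[OF h path_graph_arcI[OF that]] .
  have "\<exists>x \<in> pverts R'. h (hub u) = hub x" if u: "u \<in> pverts R" for u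
  proof -
    have ends: "path_pos l (3, u, u) (3 * l) = hub u" "path_pos l (4, u, u) (4 * l) = hub u"
      by (simp_all add: path_pos_def)
    show ?thesis
      using closed_walks_imp_hub[OF l_pos, of "\<lambda>t. h (path_pos l (3, u, u) t)" R' "h (hub u)"
          "\<lambda>t. h (path_pos l (4, u, u) t)"]
        walk[of "(3, u, u)"] walk[of "(4, u, u)"] u ends wf(2) homs_vert[OF h path_graph_hubI[OF u]]
      by simp
  qed
  then have "\<forall>u \<in> pverts R. \<exists>x. x \<in> pverts R' \<and> h (hub u) = hub x" by blast
  from bchoice[OF this]
  obtain f' where f': "\<And>u. u \<in> pverts R \<Longrightarrow> f' u \<in> pverts R' \<and> h (hub u) = hub (f' u)" by blast
  \<comment> \<open>Homomorphisms are extensional, so the chosen vertex map is made undefined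
    outside \<open>pverts R\<close>.\<close>
  define f where "f = restrict f' (pverts R)"
  have f: "f u \<in> pverts R'" "h (hub u) = hub (f u)" if "u \<in> pverts R" for u
    using f'[OF that] that by (simp_all add: f_def)
  have e: "(k, f u, f v) \<in> path_triples R' \<and>
      (\<forall>i \<le> k * l. h (path_pos l (k, u, v) i) = path_pos l (k, f u, f v) i)"
    if e: "(k, u, v) \<in> path_triples R" for k u v
  proof -
    have k: "k \<in> {3, 4, 5}" using fst_path_triples[OF e] by simp
    have uv: "u \<in> pverts R" "v \<in> pverts R" using path_triples_verts[OF wf(1) e] by auto
    let ?w = "\<lambda>t. h (path_pos l (k, u, v) t)"
    have "path_pos l (k, u, v) (k * l) = hub v" using path_pos_end[OF l_pos, of "(k, u, v)"] k by auto
    then have ends: "?w 0 = hub (f u)" "?w (k * l) = hub (f v)" using f uv by simp_all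
    have "\<forall>t < k * l. (?w t, ?w (Suc t)) \<in> parcs (path_graph l R')" using walk[OF e] by simp
    from walk_between_hubs[OF l_pos this ends k] show ?thesis by blast
  qed
  have "f \<in> homs R R'"
    using e[of 5] f restrict_homsI[OF wf(1), of f R'] by (simp add: f_def)
  moreover have "h z = restrict (path_map f) (pverts (path_graph l R)) z" for z
  proof (cases "z \<in> pverts (path_graph l R)")
    case True
    then obtain k u v i where "(k, u, v) \<in> path_triples R" "i \<le> k * l" "z = path_pos l (k, u, v) i"
      by (rule path_graph_vert_cases)
    with e True show ?thesis by simp
  next
    case False
    then show ?thesis using homs_outside[OF h] by simp
  qed
  ultimately show thesis using that by blast
qed

lemma bij_betw_path_map:
  assumes "pair_wf_digraph R" "pair_wf_digraph R'"
  shows "bij_betw (\<lambda>f. restrict (path_map f) (pverts (path_graph l R)))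
    (homs R R') (homs (path_graph l R) (path_graph l R'))"
proof (rule bij_betwI')
  fix f g assume fg: "f \<in> homs R R'" "g \<in> homs R R'"
  show "restrict (path_map f) (pverts (path_graph l R)) = restrict (path_map g) (pverts (path_graph l R))
    \<longleftrightarrow> f = g"
  proof
    assume eq: "restrict (path_map f) (pverts (path_graph l R)) = restrict (path_map g) (pverts (path_graph l R))"
    have "f u = g u" if "u \<in> pverts R" for u
      using fun_cong[OF eq, of "hub u"] path_graph_hubI[OF that] by simp
    then show "f = g" using fg unfolding homs_def by (blast intro: PiE_ext)
  qed simp
next
  fix f assume "f \<in> homs R R'"
  then show "restrict (path_map f) (pverts (path_graph l R)) \<in> homs (path_graph l R) (path_graph l R')"
    using path_map_hom assms(1) by blast
next
  fix h assume "h \<in> homs (path_graph l R) (path_graph l R')"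
  then show "\<exists>f \<in> homs R R'. h = restrict (path_map f) (pverts (path_graph l R))"
    by (rule path_graph_hom_imp_path_map[OF _ assms]) blast
qed

text \<open>Every path has more than two arcs, even for \<open>l = 1\<close>, so each arc has an
  inner end, which fixes the path and the position of a reversed arc. Two different positions of one
  path would then coincide although one of them is inner.\<close>

lemma oriented_graph_path_graph:
  assumes "pair_wf_digraph R" "finite (pverts R)"
  shows "oriented_graph (path_graph l R)"
proof -
  have "pverts (path_graph l R) = (\<Union>e \<in> path_triples R. path_pos l e ` {..fst e * l})"
    unfolding path_graph_def pair_pre_digraph.simps by blast
  then have "finite (pverts (path_graph l R))" using finite_path_triples[OF assms] by simp
  moreover have "x \<in> pverts (path_graph l R) \<and> y \<in> pverts (path_graph l R) \<and> y \<noteq> x \<and>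
      (y, x) \<notin> parcs (path_graph l R)"
    if xy: "(x, y) \<in> parcs (path_graph l R)" for x y
  proof -
    obtain e i where e: "e \<in> path_triples R" "i < fst e * l" "x = path_pos l e i" "y = path_pos l e (Suc i)"
      using path_graph_arcD[OF xy] .
    note len = path_triples_length(2)[OF l_pos e(1)]
    have "y \<noteq> x"
    proof (cases "i = 0")
      case True
      then show ?thesis using e len by (simp add: path_pos_inner)
    next
      case False
      then show ?thesis using e path_pos_inner_eqD(2)[of l e i e "Suc i"] by auto
    qed
    moreover have "(y, x) \<notin> parcs (path_graph l R)"
    proof
      assume "(y, x) \<in> parcs (path_graph l R)"
      then obtain e' j where e': "e' \<in> path_triples R" "j < fst e' * l"
        "y = path_pos l e' j" "x = path_pos l e' (Suc j)"
        by (rule path_graph_arcD)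
      show False
      proof (cases "0 < i")
        case True
        then have "e' = e" and i: "Suc j = i"
          using path_pos_inner_eqD[of l e i e' "Suc j"] e e' by auto
        show False
        proof (cases "Suc i < fst e * l")
          case True
          then show False using path_pos_inner_eqD(2)[of l e "Suc i" e' j] e e' i by auto
        next
          case False
          then show False
            using path_pos_inner_eqD(2)[of l e' j e "Suc i"] e e' i len \<open>e' = e\<close> by auto
        qed
      next
        case False
        then have "e' = e" and j: "j = 1" using path_pos_inner_eqD[of l e 1 e' j] e e' len by auto
        then show False using path_pos_inner_eqD(2)[of l e 2 e i] False e e' len by (auto simp: numeral_2_eq_2)
      qed
    qed
    ultimately show ?thesis
      using e path_graph_vertI[OF e(1), of i l] path_graph_vertI[OF e(1), of "Suc i" l] by simp
  qed
  ultimately show ?thesis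
    unfolding oriented_graph_def pair_digraph_iff by blast
qed

end

section \<open>Full embeddings of categories obtained from the encoding\<close>

lemma path_map_restrict_id:
  assumes "pair_wf_digraph R" "z \<in> pverts (path_graph l R)"
  shows "path_map (restrict id (pverts R)) z = z"
proof -
  obtain k u v i where "(k, u, v) \<in> path_triples R" "i \<le> k * l" "z = path_pos l (k, u, v) i"
    using assms(2) by (rule path_graph_vert_cases)
  then show ?thesis using path_triples_verts[OF assms(1)] by simp
qed

lemma path_map_compose:
  assumes "pair_wf_digraph R" "z \<in> pverts (path_graph l R)"
  shows "path_map (compose (pverts R) g f) z = path_map g (path_map f z)"
proof -
  obtain k u v i where "(k, u, v) \<in> path_triples R" "i \<le> k * l" "z = path_pos l (k, u, v) i"
    using assms(2) by (rule path_graph_vert_cases)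
  then show ?thesis using path_triples_verts[OF assms(1)] by (simp add: compose_def)
qed

text \<open>Stated for any category whose morphisms are the homomorphisms between relations
  \<open>rel X\<close>, loops allowed, so that oriented graphs (\<open>rel = id\<close>) and finite
  ordinals (\<open>rel = order_graph\<close>) are covered alike.\<close>

lemma embeds_path_graph:
  fixes A :: "('o, nat \<Rightarrow> nat) cat" and rel :: "'o \<Rightarrow> ngraph"
  assumes l_pos: "0 < l" and A: "category A" and S: "category (graph_category S)"
    and wf: "\<And>X. X \<in> Ob A \<Longrightarrow> pair_wf_digraph (rel X)"
    and in_S: "\<And>X. X \<in> Ob A \<Longrightarrow> path_graph l (rel X) \<in> S"
    and Hom: "\<And>X Y. X \<in> Ob A \<Longrightarrow> Y \<in> Ob A \<Longrightarrow> Hom A X Y = homs (rel X) (rel Y)"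
    and Comp: "\<And>X Y Z. X \<in> Ob A \<Longrightarrow> Comp A X Y Z = compose (pverts (rel X))"
    and Idm: "\<And>X. X \<in> Ob A \<Longrightarrow> Idm A X = restrict id (pverts (rel X))"
  shows "embeds (graph_category S) A"
proof -
  let ?Fo = "\<lambda>X. path_graph l (rel X)"
  let ?Fm = "\<lambda>X (Y :: 'o) f. restrict (path_map f) (pverts (path_graph l (rel X)))"
  have "fully_faithful_functor A (graph_category S) ?Fo ?Fm"
  proof (intro fully_faithful_functor.intro fully_faithful_functor_axioms.intro A S)
    fix X Y Z f g
    assume X: "X \<in> Ob A" and Y: "Y \<in> Ob A" and Z: "Z \<in> Ob A"
      and f: "f \<in> Hom A X Y" and g: "g \<in> Hom A Y Z"
    have "path_map f z \<in> pverts (?Fo Y)" if z: "z \<in> pverts (?Fo X)" for z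
      using homs_vert[OF path_map_hom[OF l_pos _ wf[OF X]] z, of f "rel Y"] f z X Y by (simp add: Hom)
    then show "?Fm X Z (Comp A X Y Z g f)
      = Comp (graph_category S) (?Fo X) (?Fo Y) (?Fo Z) (?Fm Y Z g) (?Fm X Y f)"
      by (auto simp: graph_category_def compose_def[of "pverts (path_graph l (rel X))"]
        Comp[OF X] path_map_compose[OF wf[OF X]] intro!: restrict_ext)
  next
    fix X assume "X \<in> Ob A"
    then show "?Fo X \<in> Ob (graph_category S)"
      and "?Fm X X (Idm A X) = Idm (graph_category S) (?Fo X)"
      by (auto simp: graph_category_def in_S Idm path_map_restrict_id[OF wf] intro!: restrict_ext)
  next
    fix X Y assume "X \<in> Ob A" "Y \<in> Ob A"
    then show "bij_betw (?Fm X Y) (Hom A X Y) (Hom (graph_category S) (?Fo X) (?Fo Y))"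
      using bij_betw_path_map[OF l_pos wf wf] by (simp add: graph_category_def Hom)
  qed
  then show ?thesis unfolding embeds_def by blast
qed

lemma embeds_trans:
  assumes "embeds C B" "embeds B A"
  shows "embeds C A"
proof -
  obtain Fo Fm Go Gm where F: "fully_faithful_functor A B Fo Fm" and G: "fully_faithful_functor B C Go Gm"
    using assms unfolding embeds_def by blast
  interpret F: fully_faithful_functor A B Fo Fm by (fact F)
  interpret G: fully_faithful_functor B C Go Gm by (fact G)
  have Fm: "Fm X Y f \<in> Hom B (Fo X) (Fo Y)" if "X \<in> Ob A" "Y \<in> Ob A" "f \<in> Hom A X Y" for X Y f
    using F.Fm_bij[OF that(1,2)] that(3) by (auto simp: bij_betw_def)
  have "fully_faithful_functor A C (\<lambda>X. Go (Fo X)) (\<lambda>X Y f. Gm (Fo X) (Fo Y) (Fm X Y f))"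
  proof (unfold_locales)
    fix X Y assume "X \<in> Ob A" "Y \<in> Ob A"
    then have "bij_betw (Gm (Fo X) (Fo Y) \<circ> Fm X Y) (Hom A X Y) (Hom C (Go (Fo X)) (Go (Fo Y)))"
      by (intro bij_betw_trans[OF F.Fm_bij G.Fm_bij] F.Fo_in_Ob)
    then show "bij_betw (\<lambda>f. Gm (Fo X) (Fo Y) (Fm X Y f)) (Hom A X Y) (Hom C (Go (Fo X)) (Go (Fo Y)))"
      by (simp add: comp_def)
  qed (simp_all add: F.Fo_in_Ob G.Fo_in_Ob F.Fm_Idm G.Fm_Idm F.Fm_Comp G.Fm_Comp Fm)
  then show ?thesis unfolding embeds_def by blast
qed

lemma full_subcategory_OGra: "full_subcategory OGra \<D> = graph_category \<D>"
  by (simp add: full_subcategory_def OGra_def graph_category_def)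

lemma category_oriented_graphs:
  assumes "\<And>D. D \<in> \<D> \<Longrightarrow> oriented_graph D"
  shows "category (graph_category \<D>)"
  using assms
  by (intro category_graph_category)
    (auto simp: oriented_graph_def pair_digraph_def pair_fin_digraph_def)

text \<open>The pairs \<open>(i, i)\<close> allow a homomorphism to identify elements; homomorphisms
  are then exactly the weakly monotone maps.\<close>

definition order_graph :: "nat \<Rightarrow> ngraph" where
  "order_graph n = \<lparr>pverts = {0..n}, parcs = {(i, j). i \<le> j \<and> j \<le> n}\<rparr>"

lemma embeds_Simplicial:
  assumes "0 < l" "\<And>D. D \<in> \<D> \<Longrightarrow> oriented_graph D" "\<And>n. path_graph l (order_graph n) \<in> \<D>"
  shows "embeds (graph_category \<D>) Simplicial"
proof (rule embeds_path_graph[OF assms(1) category_Simplicial, where rel = order_graph])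
  show "Hom Simplicial m n = homs (order_graph m) (order_graph n)" for m n
  proof -
    have "mono_on {0..m} f \<longleftrightarrow> (\<forall>(i, j) \<in> parcs (order_graph m). (f i, f j) \<in> parcs (order_graph n))"
      if "f \<in> {0..m} \<rightarrow> {0..n}" for f
      using that by (auto simp: order_graph_def monotone_on_def Pi_iff)
    then show ?thesis by (auto simp: Simplicial_def homs_def order_graph_def PiE_def)
  qed
qed (use assms category_oriented_graphs in \<open>auto simp: Simplicial_def order_graph_def pair_wf_digraph_iff\<close>)

lemma embeds_OGra:
  assumes "0 < l" "\<And>D. D \<in> \<D> \<Longrightarrow> oriented_graph D"
    and "\<And>D. oriented_graph D \<Longrightarrow> path_graph l D \<in> \<D>"
  shows "embeds (graph_category \<D>) OGra"
  by (rule embeds_path_graph[OF assms(1) category_OGra category_oriented_graphs[OF assms(2)], where rel = id])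
    (use assms(3) in \<open>auto simp: OGra_def graph_category_def oriented_graph_def pair_digraph_iff pair_wf_digraph_iff\<close>)


section \<open>Subdivided complete graphs in somewhere dense classes\<close>

lemma sub_path_vert:
  assumes "pair_wf_digraph G" "(u, v) \<in> parcs G" "u < v" "i \<le> Suc p"
  shows "sub_path p u v i \<in> pverts (Sub p G)"
  using assms by (auto simp: sub_path_def Sub_def pair_wf_digraph_iff)

lemma Sub_arcs_iff:
  "(x, y) \<in> parcs (Sub p G) \<longleftrightarrow> (\<exists>u v i. (u, v) \<in> parcs G \<and> u < v \<and> i \<le> p \<and>
    (x = sub_path p u v i \<and> y = sub_path p u v (Suc i) \<or> y = sub_path p u v i \<and> x = sub_path p u v (Suc i)))"
  by (auto simp: Sub_def Let_def)

lemma pair_wf_digraph_Sub: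
  assumes "pair_wf_digraph G"
  shows "pair_wf_digraph (Sub p G)"
  unfolding pair_wf_digraph_iff split_beta Sub_arcs_iff[of "fst _" "snd _", simplified]
  using sub_path_vert[OF assms] by (auto simp: Sub_arcs_iff)

lemma pair_wf_digraph_complete_graph: "pair_wf_digraph (complete_graph N)"
  by (auto simp: pair_wf_digraph_iff complete_graph_def)

text \<open>The \<open>i\<close>-th vertex of the subdivided edge, traversed from \<open>a\<close> to \<open>b\<close>.\<close>

definition sub_walk :: "nat \<Rightarrow> nat \<Rightarrow> nat \<Rightarrow> nat \<Rightarrow> nat sub_vertex" where
  "sub_walk p a b i = (if a < b then sub_path p a b i else sub_path p b a (Suc p - i))"

lemma sub_walk_ends [simp]: "sub_walk p a b 0 = Branch a" "sub_walk p a b (Suc p) = Branch b"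
  by (simp_all add: sub_walk_def sub_path_def)

lemma sub_walk_inner:
  "0 < i \<Longrightarrow> i \<le> p \<Longrightarrow> sub_walk p a b i = Inner (min a b) (max a b) (if a < b then i else Suc p - i)"
  by (auto simp: sub_walk_def sub_path_def)

lemma sub_walk_arc:
  assumes "a \<noteq> b" "a < N" "b < N" "i \<le> p"
  shows "(sub_walk p a b i, sub_walk p a b (Suc i)) \<in> parcs (Sub p (complete_graph N))"
proof (cases "a < b")
  case True
  then show ?thesis
    using assms unfolding Sub_arcs_iff
    by (intro exI[of _ a] exI[of _ b] exI[of _ i]) (simp add: sub_walk_def complete_graph_def)
next
  case False
  then show ?thesis
    using assms unfolding Sub_arcs_iff
    by (intro exI[of _ b] exI[of _ a] exI[of _ "p - i"])
      (simp add: sub_walk_def complete_graph_def Suc_diff_le)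
qed

text \<open>Positions that are multiples of \<open>l\<close> correspond to the vertices of
  \<open>path_graph 1 R\<close>; \<open>path_graph l R\<close> arises from it by subdividing each
  arc \<open>l - 1\<close> times.\<close>

lemma path_pos_multiple_eq_iff:
  assumes "0 < l" "q \<le> fst e" "q' \<le> fst e'"
  shows "path_pos l e (q * l) = path_pos l e' (q' * l) \<longleftrightarrow> path_pos 1 e q = path_pos 1 e' q'"
  using assms by (auto simp: path_pos_def)

lemma path_graph_arc_unique:
  assumes "e \<in> path_triples R" "q < fst e" "e' \<in> path_triples R" "q' < fst e'"
    and "path_pos 1 e q = path_pos 1 e' q'" "path_pos 1 e (Suc q) = path_pos 1 e' (Suc q')"
  shows "e' = e" "q' = q"
proof -
  have len: "2 < fst e" using path_triples_length(2)[of 1 e R] assms(1) by simp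
  have "e' = e \<and> q' = q"
  proof (cases "q = 0")
    case True
    then show ?thesis using path_pos_inner_eqD[OF assms(6)] len by simp
  next
    case False
    then show ?thesis using path_pos_inner_eqD[OF assms(5)] assms(2) by simp
  qed
  then show "e' = e" "q' = q" by simp_all
qed

text \<open>The finitely many vertices of \<open>path_graph 1 R\<close> lie below some
  \<open>N\<close>, so its underlying graph is a subgraph of \<open>complete_graph N\<close>.
  Subdividing both graphs \<open>p\<close> times gives the embedding.\<close>

lemma path_graph_in_Sub:
  assumes wf: "pair_wf_digraph R" and fin: "finite (pverts R)"
  shows "\<exists>N f. graph_embedding (underlying_graph (path_graph (Suc p) R)) (Sub p (complete_graph N)) f"
proof -
  define l where "l = Suc p"
  have l_pos: "0 < l" by (simp add: l_def)
  \<comment> \<open>\<open>i div l\<close> selects the arc of \<open>path_graph 1 R\<close> in which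
    position \<open>i\<close> falls, and \<open>i mod l\<close> the place on the subdivision of that
    arc.\<close>
  define J where "J = (\<lambda>e i. sub_walk p (path_pos 1 e (i div l)) (path_pos 1 e (Suc (i div l))) (i mod l))"
  have ori: "oriented_graph (path_graph 1 R)" using oriented_graph_path_graph[of 1] wf fin by simp
  then have "finite (pverts (path_graph 1 R))" by (simp add: oriented_graph_def pair_digraph_iff)
  then obtain N where N: "\<And>x. x \<in> pverts (path_graph 1 R) \<Longrightarrow> x < N"
    by (auto simp: finite_nat_set_iff_bounded)
  have arc: "(path_pos 1 e q, path_pos 1 e (Suc q)) \<in> parcs (path_graph 1 R)"
    if "e \<in> path_triples R" "q < fst e" for e q using path_graph_arcI[of e R q 1] that by simp
  have arc_facts: "path_pos 1 e q \<noteq> path_pos 1 e (Suc q)" "path_pos 1 e q < N" "path_pos 1 e (Suc q) < N"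
    if "e \<in> path_triples R" "q < fst e" for e q
    using arc[OF that] ori path_graph_vertI[of e R q 1] path_graph_vertI[of e R "Suc q" 1] that N
    by (auto simp: oriented_graph_def pair_digraph_iff)
  have J_branch: "J e (q * l) = Branch (path_pos 1 e q)" for e q
    using l_pos by (simp add: J_def)
  have div_less: "i div l < fst e" if "i < fst e * l" for i and e :: "nat \<times> nat \<times> nat"
    using that l_pos by (simp add: less_mult_imp_div_less)
  have J_arc: "(J e i, J e (Suc i)) \<in> parcs (Sub p (complete_graph N))"
    if e: "e \<in> path_triples R" "i < fst e * l" for e i
  proof -
    let ?a = "path_pos 1 e (i div l)" and ?b = "path_pos 1 e (Suc (i div l))"
    have "J e (Suc i) = sub_walk p ?a ?b (Suc (i mod l))"
    proof (cases "Suc (i mod l) = l")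
      case True
      \<comment> \<open>The last step on a subdivided arc ends at a branch vertex, which
        \<open>J\<close> computes as place 0 for the next quotient.\<close>
      then have "Suc i = Suc (i div l) * l"
        by (metis add_Suc_right add.commute div_mult_mod_eq mult_Suc)
      then show ?thesis using J_branch[of e "Suc (i div l)"] True by (simp add: l_def)
    next
      case False
      then show ?thesis using l_pos by (simp add: J_def mod_Suc div_Suc)
    qed
    moreover have "i mod l \<le> p" using l_pos mod_less_divisor[of l i] by (simp add: l_def)
    ultimately show ?thesis
      using sub_walk_arc[of ?a ?b N "i mod l" p] arc_facts[OF e(1) div_less[OF e(2)]]
      by (simp add: J_def)
  qed
  have J_vert: "J e i \<in> pverts (Sub p (complete_graph N))"
    if e: "e \<in> path_triples R" "i \<le> fst e * l" for e i
  proof -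
    have arc_verts: "x \<in> pverts (Sub p (complete_graph N)) \<and> y \<in> pverts (Sub p (complete_graph N))"
      if "(x, y) \<in> parcs (Sub p (complete_graph N))" for x y
      using pair_wf_digraph_Sub[OF pair_wf_digraph_complete_graph] that
      unfolding pair_wf_digraph_iff by blast
    show ?thesis
    proof (cases i)
      case 0
      have "0 < fst e * l" using path_triples_length(2)[OF l_pos e(1)] by linarith
      from arc_verts[OF J_arc[OF e(1) this]] 0 show ?thesis by simp
    next
      case (Suc j)
      then have "j < fst e * l" using e(2) by simp
      from arc_verts[OF J_arc[OF e(1) this]] Suc show ?thesis by simp
    qed
  qed
  have J_inner: "J e i = Inner (min a b) (max a b) (if a < b then i mod l else l - i mod l)"
    if "i mod l \<noteq> 0" "a = path_pos 1 e (i div l)" "b = path_pos 1 e (Suc (i div l))" for e i a b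
    using that mod_less_divisor[of l i] unfolding J_def by (subst sub_walk_inner) (auto simp: l_def)
  have pos_imp_J: "J e i = J e' j"
    if e: "e \<in> path_triples R" "i \<le> fst e * l" and e': "e' \<in> path_triples R" "j \<le> fst e' * l"
      and eq: "path_pos l e i = path_pos l e' j" for e i e' j
  proof -
    \<comment> \<open>Inner vertices have a unique name; only the ends of paths are shared. The ends
      are written as multiples of \<open>l\<close>, where \<open>J\<close> gives branch
      vertices.\<close>
    consider "0 < i" "i < fst e * l" | "0 < j" "j < fst e' * l"
      | "i \<in> {0 * l, fst e * l}" "j \<in> {0 * l, fst e' * l}"
      using e(2) e'(2) by fastforce
    then show ?thesis
    proof cases
      case 1
      then show ?thesis using path_pos_inner_eqD[OF eq] by simp
    next
      case 2
      then show ?thesis using path_pos_inner_eqD[OF eq[symmetric]] by simp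
    next
      case 3
      then obtain q q' where "i = q * l" "q \<le> fst e" "j = q' * l" "q' \<le> fst e'"
        by fastforce
      then show ?thesis using eq path_pos_multiple_eq_iff[OF l_pos, of q e q' e'] by (simp add: J_branch)
    qed
  qed
  have J_imp_pos: "path_pos l e i = path_pos l e' j"
    if e: "e \<in> path_triples R" "i \<le> fst e * l" and e': "e' \<in> path_triples R" "j \<le> fst e' * l"
      and eq: "J e i = J e' j" for e i e' j
  proof (cases "i mod l = 0 \<or> j mod l = 0")
    case True
    have Branch: "\<exists>q \<le> fst e. i = q * l" if "J e i = Branch x" "i \<le> fst e * l" for e i x
    proof -
      have "i mod l = 0" using that(1) J_inner[of i _ e] by (metis sub_vertex.distinct(1))
      then obtain q where "i = q * l" by (metis mod_0_imp_dvd dvd_def mult.commute)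
      with that(2) l_pos show ?thesis by auto
    qed
    have "\<exists>x. J e i = Branch x"
    proof (cases "i mod l = 0")
      case True
      then show ?thesis by (simp add: J_def)
    next
      case False
      with True have "J e' j = Branch (path_pos 1 e' (j div l))" by (simp add: J_def)
      with eq show ?thesis by simp
    qed
    then obtain q q' where "i = q * l" "q \<le> fst e" "j = q' * l" "q' \<le> fst e'"
      using Branch e(2) e'(2) eq by metis
    then show ?thesis using eq path_pos_multiple_eq_iff[OF l_pos, of q e q' e'] by (simp add: J_branch)
  next
    case False
    then have lt: "i < fst e * l" "j < fst e' * l"
      using e(2) e'(2) by (metis le_neq_implies_less mod_mult_self2_is_0)+
    define a b a' b' where "a = path_pos 1 e (i div l)" and "b = path_pos 1 e (Suc (i div l))"
      and "a' = path_pos 1 e' (j div l)" and "b' = path_pos 1 e' (Suc (j div l))"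
    note J = J_inner[OF _ a_def b_def] J_inner[OF _ a'_def b'_def]
    have "min a b = min a' b'" "max a b = max a' b'"
      and r: "(if a < b then i mod l else l - i mod l) = (if a' < b' then j mod l else l - j mod l)"
      using eq J False by simp_all
    \<comment> \<open>An inner vertex of the subdivision determines only an unordered pair of branch
      vertices. Orientedness of \<open>path_graph 1 R\<close> then excludes the reversed
      pair.\<close>
    then have "a = a' \<and> b = b' \<or> a = b' \<and> b = a'"
      by (auto simp: min_def max_def split: if_splits)
    moreover have "(a, b) \<in> parcs (path_graph 1 R)" "(a', b') \<in> parcs (path_graph 1 R)"
      using arc[OF e(1) div_less[OF lt(1)]] arc[OF e'(1) div_less[OF lt(2)]]
      by (simp_all add: a_def b_def a'_def b'_def)
    ultimately have ab: "a = a'" "b = b'" using ori by (auto simp: oriented_graph_def)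
    then have "e' = e" and "j div l = i div l"
      using path_graph_arc_unique[OF e(1) div_less[OF lt(1)] e'(1) div_less[OF lt(2)]]
      by (simp_all add: a_def b_def a'_def b'_def)
    moreover have "i mod l = j mod l"
      using r ab mod_less_divisor[OF l_pos, of i] mod_less_divisor[OF l_pos, of j] by (auto split: if_splits)
    ultimately have "i = j" by (metis div_mult_mod_eq)
    with \<open>e' = e\<close> show ?thesis by simp
  qed
  define dom where "dom = Sigma (path_triples R) (\<lambda>e. {..fst e * l})"
  \<comment> \<open>A hub may have several names \<open>(e, i)\<close>. One is picked by
    \<open>inv_into\<close>, and by \<open>pos_imp_J\<close> the choice does not matter.\<close>
  define f where "f = (\<lambda>z. case inv_into dom (case_prod (path_pos l)) z of (e, i) \<Rightarrow> J e i)"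
  have f: "f (path_pos l e i) = J e i" if "e \<in> path_triples R" "i \<le> fst e * l" for e i
  proof -
    have im: "path_pos l e i \<in> case_prod (path_pos l) ` dom"
      using that by (force simp: dom_def)
    obtain e' j where ej: "inv_into dom (case_prod (path_pos l)) (path_pos l e i) = (e', j)" by fastforce
    then have "(e', j) \<in> dom" "path_pos l e' j = path_pos l e i"
      using inv_into_into[OF im] f_inv_into_f[OF im] by simp_all
    then show ?thesis using pos_imp_J[of e' j e i] that ej by (simp add: f_def dom_def)
  qed
  have "inj_on f (pverts (path_graph l R))"
  proof (rule inj_onI)
    fix x y assume "x \<in> pverts (path_graph l R)" "y \<in> pverts (path_graph l R)" and eq: "f x = f y"
    then obtain e i e' j where "e \<in> path_triples R" "i \<le> fst e * l" "x = path_pos l e i"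
      "e' \<in> path_triples R" "j \<le> fst e' * l" "y = path_pos l e' j"
      unfolding path_graph_def by (simp del: split_paired_Ex) blast
    with eq show "x = y" using J_imp_pos[of e i e' j] f by simp
  qed
  moreover have "f ` pverts (path_graph l R) \<subseteq> pverts (Sub p (complete_graph N))"
  proof (rule image_subsetI)
    fix x assume "x \<in> pverts (path_graph l R)"
    then obtain e i where "e \<in> path_triples R" "i \<le> fst e * l" "x = path_pos l e i"
      unfolding path_graph_def by (simp del: split_paired_Ex) blast
    then show "f x \<in> pverts (Sub p (complete_graph N))" using J_vert[of e i] f by simp
  qed
  moreover have "(f x, f y) \<in> parcs (Sub p (complete_graph N))" if xy: "(x, y) \<in> parcs (path_graph l R)" for x y
  proof -
    obtain e i where "e \<in> path_triples R" "i < fst e * l" "x = path_pos l e i" "y = path_pos l e (Suc i)"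
      using path_graph_arcD[OF xy] .
    then show ?thesis using J_arc f by simp
  qed
  moreover have "(y, x) \<in> parcs (Sub p (complete_graph N))" if "(x, y) \<in> parcs (Sub p (complete_graph N))" for x y
    using that unfolding Sub_arcs_iff by blast
  ultimately have "graph_embedding (underlying_graph (path_graph l R)) (Sub p (complete_graph N)) f"
    unfolding graph_embedding_def by auto
  then show ?thesis unfolding l_def by blast
qed

lemma graph_embedding_trans:
  assumes "graph_embedding G H f" "graph_embedding H K g"
  shows "graph_embedding G K (g \<circ> f)"
proof -
  have "inj_on g (f ` pverts G)" using assms by (auto simp: graph_embedding_def intro: inj_on_subset)
  then show ?thesis using assms by (auto simp: graph_embedding_def intro!: comp_inj_on)
qed

text \<open>Somewhere density supplies one \<open>p\<close> for all \<open>N\<close>. Hence a single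
  \<open>l = Suc p\<close> serves all relations \<open>R\<close>, while \<open>N\<close> and the
  member of \<open>\<K>\<close> vary with \<open>R\<close>.\<close>

lemma somewhere_dense_imp_orientations:
  assumes \<K>: "graph_class \<K>" "monotone_class \<K>" and "somewhere_dense \<K>"
  shows "\<exists>l > 0. \<forall>R. pair_wf_digraph R \<and> finite (pverts R) \<longrightarrow> path_graph l R \<in> orientations \<K>"
proof -
  obtain p where p: "\<And>N. \<exists>G \<in> \<K>. iso_to_subgraph (Sub p (complete_graph N)) G"
    using assms(3) by (auto simp: somewhere_dense_def nowhere_dense_def)
  have "path_graph (Suc p) R \<in> orientations \<K>" if R: "pair_wf_digraph R" "finite (pverts R)" for R
  proof -
    obtain N f where f: "graph_embedding (underlying_graph (path_graph (Suc p) R)) (Sub p (complete_graph N)) f"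
      using path_graph_in_Sub[OF R] by blast
    obtain G where G: "G \<in> \<K>" "iso_to_subgraph (Sub p (complete_graph N)) G" using p by blast
    then have "pair_wf_digraph G"
      using \<K>(1) by (auto simp: graph_class_def Gra_def graph_category_def pair_graph_imp_wf)
    with G(2) obtain g where "graph_embedding (Sub p (complete_graph N)) G g"
      using iso_to_subgraph_iff[OF pair_wf_digraph_Sub[OF pair_wf_digraph_complete_graph]] by blast
    then have emb: "graph_embedding (underlying_graph (path_graph (Suc p) R)) G (g \<circ> f)"
      by (rule graph_embedding_trans[OF f])
    have ori: "oriented_graph (path_graph (Suc p) R)" using R by (intro oriented_graph_path_graph) simp_all
    then have "pair_graph (underlying_graph (path_graph (Suc p) R))"
      by (simp add: oriented_graph_def pair_graph_underlying_graph)
    from monotone_class_embedding[OF \<K> G(1) this emb] ori show ?thesis by (simp add: orientations_def)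
  qed
  then show ?thesis by blast
qed

section \<open>Cosimplicial structure of an embedded simplicial category\<close>

abbreviation mor :: "nat \<Rightarrow> (nat \<Rightarrow> nat) \<Rightarrow> nat \<Rightarrow> nat" where
  "mor m \<theta> \<equiv> restrict \<theta> {0..m}"

abbreviation edge_map :: "nat \<Rightarrow> nat \<Rightarrow> nat \<Rightarrow> nat" where
  "edge_map i j \<equiv> mor 1 (\<lambda>t. if t = 0 then i else j)"

locale embedded_Simplicial =
  fully_faithful_functor Simplicial "graph_category \<D>" \<Phi> \<Psi>
  for \<D> :: "ngraph set" and \<Phi> :: "nat \<Rightarrow> ngraph" and \<Psi> :: "nat \<Rightarrow> nat \<Rightarrow> (nat \<Rightarrow> nat) \<Rightarrow> nat \<Rightarrow> nat" +
  assumes digraphs: "D \<in> \<D> \<Longrightarrow> pair_digraph D"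
begin

lemma \<Phi>_in: "\<Phi> n \<in> \<D>"
  using Fo_in_Ob[of n] by (simp add: Simplicial_def graph_category_def)

lemma mor_in_Hom:
  assumes "\<And>s t. s \<le> t \<Longrightarrow> t \<le> m \<Longrightarrow> \<theta> s \<le> \<theta> t" "\<And>t. t \<le> m \<Longrightarrow> \<theta> t \<le> n"
  shows "mor m \<theta> \<in> Hom Simplicial m n"
  using assms by (auto simp: Simplicial_def monotone_on_def)

lemma \<Psi>_bij: "bij_betw (\<Psi> m n) (Hom Simplicial m n) (homs (\<Phi> m) (\<Phi> n))"
  using Fm_bij[of m n] by (simp add: Simplicial_def graph_category_def)

lemma \<Psi>_hom: "\<theta> \<in> Hom Simplicial m n \<Longrightarrow> \<Psi> m n \<theta> \<in> homs (\<Phi> m) (\<Phi> n)"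
  using bij_betwE[OF \<Psi>_bij] by blast

lemma \<Psi>_compose:
  assumes "\<theta> \<in> Hom Simplicial m n" "\<eta> \<in> Hom Simplicial n k" "x \<in> pverts (\<Phi> m)"
  shows "\<Psi> n k \<eta> (\<Psi> m n \<theta> x) = \<Psi> m k (mor m (\<lambda>t. \<eta> (\<theta> t))) x"
  using Fm_Comp[of m n k \<theta> \<eta>] assms
  by (simp add: Simplicial_def graph_category_def compose_def)

text \<open>These are the maps sending x to x_ij in the overview.\<close>

definition edge :: "nat \<Rightarrow> nat \<Rightarrow> nat \<Rightarrow> nat \<Rightarrow> nat" where
  "edge n i j = \<Psi> 1 n (edge_map i j)"

abbreviation V where "V \<equiv> pverts (\<Phi> 1)"

lemma edge_map_in_Hom: "i \<le> j \<Longrightarrow> j \<le> n \<Longrightarrow> edge_map i j \<in> Hom Simplicial 1 n"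
  by (rule mor_in_Hom) auto

lemma edge_hom: "i \<le> j \<Longrightarrow> j \<le> n \<Longrightarrow> edge n i j \<in> homs (\<Phi> 1) (\<Phi> n)"
  unfolding edge_def by (intro \<Psi>_hom edge_map_in_Hom)

lemma mor_edge:
  assumes "mor n \<theta> \<in> Hom Simplicial n k" "i \<le> j" "j \<le> n" "x \<in> V"
  shows "\<Psi> n k (mor n \<theta>) (edge n i j x) = edge k (\<theta> i) (\<theta> j) x"
proof -
  have "mor 1 (\<lambda>t. mor n \<theta> (edge_map i j t)) = edge_map (\<theta> i) (\<theta> j)"
    using assms(2,3) by (auto simp: fun_eq_iff)
  then show ?thesis
    using \<Psi>_compose[OF edge_map_in_Hom assms(1,4), of i j] assms(2,3) by (simp add: edge_def)
qed

text \<open>By functoriality, monotone maps carry coincidences between images to coincidences. The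
  comparisons below differ in the choice of \<open>\<theta>\<close>.\<close>

lemma edge_eq_mono:
  assumes "edge n i j x = edge n i' j' y" "i \<le> j" "j \<le> n" "i' \<le> j'" "j' \<le> n" "x \<in> V" "y \<in> V"
    and "\<forall>s t. s \<le> t \<longrightarrow> t \<le> n \<longrightarrow> \<theta> s \<le> \<theta> t" "\<forall>t \<le> n. \<theta> t \<le> k"
  shows "edge k (\<theta> i) (\<theta> j) x = edge k (\<theta> i') (\<theta> j') y"
proof -
  have \<theta>: "mor n \<theta> \<in> Hom Simplicial n k" using assms(8,9) by (intro mor_in_Hom) blast+
  show ?thesis
    using mor_edge[OF \<theta> assms(2,3,6)] mor_edge[OF \<theta> assms(4,5,7)] assms(1) by simp
qed

lemma edge_01: "x \<in> V \<Longrightarrow> edge 1 0 1 x = x"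
proof -
  assume x: "x \<in> V"
  have "edge_map 0 1 = restrict id {0..1}" by (auto simp: fun_eq_iff)
  moreover have "\<Psi> 1 1 (restrict id {0..1}) = restrict id V"
    using Fm_Idm[of 1] by (simp add: Simplicial_def graph_category_def)
  ultimately have "edge 1 0 1 = restrict id V" unfolding edge_def by metis
  then show "edge 1 0 1 x = x" using x by simp
qed

text \<open>A monotone map to \<open>[1]\<close> that separates \<open>i\<close> from
  \<open>j\<close> is a left inverse of \<open>edge_map i j\<close>, and the identity of
  \<open>[1]\<close> acts as the identity on \<open>V\<close>.\<close>

lemma edge_inj:
  assumes "edge n i j x = edge n i j y" "i < j" "j \<le> n" "x \<in> V" "y \<in> V"
  shows "x = y"
proof -
  let ?\<theta> = "\<lambda>t. if t \<le> i then 0 else (1 :: nat)"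
  have "edge 1 (?\<theta> i) (?\<theta> j) x = edge 1 (?\<theta> i) (?\<theta> j) y"
    by (rule edge_eq_mono[OF assms(1), where \<theta> = ?\<theta>]) (use assms(2-) in auto)
  then show ?thesis using assms(2,4,5) edge_01 by simp
qed

section \<open>Dependence of the images on the two indices\<close>

definition dep_fst :: "nat \<Rightarrow> bool" where
  "dep_fst x \<longleftrightarrow> edge 2 0 2 x \<noteq> edge 2 1 2 x"

definition dep_snd :: "nat \<Rightarrow> bool" where
  "dep_snd x \<longleftrightarrow> edge 2 0 1 x \<noteq> edge 2 0 2 x"

text \<open>\<open>\<theta>\<close> collapses \<open>[n]\<close> onto \<open>[2]\<close> and
  \<open>\<eta>\<close> places \<open>[2]\<close> at \<open>i\<close>, \<open>i'\<close>,
  \<open>j\<close>. Transporting coincidences in both directions makes the test in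
  \<open>[2]\<close> decisive for all indices.\<close>

lemma dep_fst_iff:
  assumes "i < i'" "i' < j" "j \<le> n" "x \<in> V"
  shows "dep_fst x \<longleftrightarrow> edge n i j x \<noteq> edge n i' j x"
proof -
  let ?\<theta> = "\<lambda>t. if t \<le> i then 0 else if t \<le> i' then 1 else (2 :: nat)"
  let ?\<eta> = "\<lambda>t :: nat. if t = 0 then i else if t = 1 then i' else j"
  have "edge 2 (?\<theta> i) (?\<theta> j) x = edge 2 (?\<theta> i') (?\<theta> j) x" if "edge n i j x = edge n i' j x"
    by (rule edge_eq_mono[OF that, where \<theta> = ?\<theta>]) (use assms in auto)
  moreover have "edge n (?\<eta> 0) (?\<eta> 2) x = edge n (?\<eta> 1) (?\<eta> 2) x" if "edge 2 0 2 x = edge 2 1 2 x"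
    by (rule edge_eq_mono[OF that, where \<theta> = ?\<eta>]) (use assms in auto)
  ultimately show ?thesis using assms by (auto simp: dep_fst_def)
qed

lemma dep_snd_iff:
  assumes "i < j" "j < j'" "j' \<le> n" "x \<in> V"
  shows "dep_snd x \<longleftrightarrow> edge n i j x \<noteq> edge n i j' x"
proof -
  let ?\<theta> = "\<lambda>t. if t \<le> i then 0 else if t \<le> j then 1 else (2 :: nat)"
  let ?\<eta> = "\<lambda>t :: nat. if t = 0 then i else if t = 1 then j else j'"
  have "edge 2 (?\<theta> i) (?\<theta> j) x = edge 2 (?\<theta> i) (?\<theta> j') x" if "edge n i j x = edge n i j' x"
    by (rule edge_eq_mono[OF that, where \<theta> = ?\<theta>]) (use assms in auto)
  moreover have "edge n (?\<eta> 0) (?\<eta> 1) x = edge n (?\<eta> 0) (?\<eta> 2) x" if "edge 2 0 1 x = edge 2 0 2 x"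
    by (rule edge_eq_mono[OF that, where \<theta> = ?\<eta>]) (use assms in auto)
  ultimately show ?thesis using assms by (auto simp: dep_snd_def)
qed

lemma not_dep_fst:
  assumes "\<not> dep_fst x" "i < j" "i' < j" "j \<le> n" "x \<in> V"
  shows "edge n i j x = edge n i' j x"
  using assms dep_fst_iff[of i i' j n x] dep_fst_iff[of i' i j n x] by (metis linorder_neqE_nat)

lemma not_dep_snd:
  assumes "\<not> dep_snd x" "i < j" "i < j'" "j \<le> n" "j' \<le> n" "x \<in> V"
  shows "edge n i j x = edge n i j' x"
  using assms dep_snd_iff[of i j j' n x] dep_snd_iff[of i j' j n x] by (metis linorder_neqE_nat)

text \<open>
  If an index \<open>s\<close> on which the left-hand side depends did not occur on the right-hand side, then
  \<open>t \<mapsto> 2 * t\<close> and its variant with \<open>s \<mapsto> 2 * s + 1\<close> would give two different values to the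
  left-hand side and the same value to the right-hand side.
\<close>

lemma edge_eq_index:
  assumes eq: "edge n i j x = edge n i' j' y" and ord: "i < j" "j \<le> n" "i' < j'" "j' \<le> n"
    and V: "x \<in> V" "y \<in> V"
  shows "dep_fst x \<Longrightarrow> i \<in> {i', j'}" "dep_snd x \<Longrightarrow> j \<in> {i', j'}"
proof -
  have same: "edge (2 * n + 1) (2 * i) (2 * j) x
      = edge (2 * n + 1) (2 * i + (if i = s then 1 else 0)) (2 * j + (if j = s then 1 else 0)) x"
    if "s \<notin> {i', j'}" for s
    using edge_eq_mono[OF eq, of "\<lambda>t. 2 * t" "2 * n + 1"]
      edge_eq_mono[OF eq, of "\<lambda>t. 2 * t + (if t = s then 1 else 0)" "2 * n + 1"] that ord V
    by auto
  show "i \<in> {i', j'}" if "dep_fst x"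
    using same[of i] dep_fst_iff[of "2 * i" "2 * i + 1" "2 * j" "2 * n + 1" x] that ord V by auto
  show "j \<in> {i', j'}" if "dep_snd x"
    using same[of j] dep_snd_iff[of "2 * i" "2 * j" "2 * j + 1" "2 * n + 1" x] that ord V by auto
qed

text \<open>With first indices below \<open>N\<close> and second ones from \<open>N\<close> on, an
  index that \<open>edge_eq_index\<close> finds in \<open>{i', j'}\<close> must be the one in the
  same place.\<close>

lemma edge_eq_imp:
  assumes eq: "edge n i j x = edge n i' j' y" and ord: "i < N" "i' < N" "N \<le> j" "N \<le> j'" "j \<le> n" "j' \<le> n"
    and V: "x \<in> V" "y \<in> V"
  shows "x = y" "dep_fst x \<Longrightarrow> i = i'" "dep_snd x \<Longrightarrow> j = j'"
proof -
  have fst: "dep_fst x \<or> dep_fst y \<Longrightarrow> i = i'"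
    using edge_eq_index(1)[OF eq] edge_eq_index(1)[OF eq[symmetric]] ord V by auto
  have snd: "dep_snd x \<or> dep_snd y \<Longrightarrow> j = j'"
    using edge_eq_index(2)[OF eq] edge_eq_index(2)[OF eq[symmetric]] ord V by auto
  \<comment> \<open>An index on which \<open>y\<close> depends already agrees, and any other may be
    changed freely. Both sides thus get the same indices and \<open>edge_inj\<close>
    applies.\<close>
  have "edge n i' j' y = edge n i j' y"
    using fst not_dep_fst[of y i' j' i n] ord V by (cases "dep_fst y") auto
  also have "\<dots> = edge n i j y"
    using snd not_dep_snd[of y i j' j n] ord V by (cases "dep_snd y") auto
  finally show "x = y" using edge_inj[of n i j x y] eq ord V by simp
  show "dep_fst x \<Longrightarrow> i = i'" "dep_snd x \<Longrightarrow> j = j'" using fst snd by simp_all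
qed

section \<open>Paths from dependence on the first index to dependence on the second\<close>

definition link :: "nat rel" where
  "link = {(x, y) \<in> parcs (underlying_graph (\<Phi> 1)).
    (dep_fst x \<or> dep_snd x) \<and> (dep_fst y \<or> dep_snd y)}"

text \<open>
  Otherwise \<open>h\<close> below would be a homomorphism that sends the two vertices of \<open>[1]\<close> to the
  vertices \<open>2\<close> and \<open>1\<close> of \<open>[3]\<close>, in this order.
\<close>

lemma ex_link_path:
  "\<exists>x y. x \<in> V \<and> y \<in> V \<and> dep_fst x \<and> \<not> dep_snd x \<and> dep_snd y \<and> \<not> dep_fst y \<and> (x, y) \<in> link\<^sup>*"
proof (rule ccontr)
  assume no_path: "\<not> ?thesis"
  define C where "C = {y \<in> V. \<exists>x \<in> V. dep_fst x \<and> \<not> dep_snd x \<and> (x, y) \<in> link\<^sup>*}"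
  \<comment> \<open>The first index is 2 on \<open>C\<close>, the second is 1 elsewhere. So vertices
    depending only on the first index see 0 sent to 2, and those depending only on the second see 1
    sent to 1.\<close>
  define h where "h = restrict (\<lambda>x. if x \<in> C then edge 3 2 3 x else edge 3 0 1 x) V"
  have arcs: "(edge 3 i j x, edge 3 i j y) \<in> parcs (\<Phi> 3)" if "i \<le> j" "j \<le> 3" "(x, y) \<in> parcs (\<Phi> 1)" for i j x y
    using homs_arc[OF edge_hom[OF that(1,2)] that(3)] .
  have wf: "pair_wf_digraph (\<Phi> n)" for n
    using digraphs[OF \<Phi>_in] by (auto simp: pair_digraph_iff pair_wf_digraph_iff)
  have const: "edge 3 2 3 x = edge 3 0 1 x" if "\<not> dep_fst x" "\<not> dep_snd x" "x \<in> V" for x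
    using not_dep_fst[of x 2 3 0 3] not_dep_snd[of x 0 3 1 3] that by simp
  have closed: "y \<in> C" if "x \<in> C" "(x, y) \<in> link" for x y
    using that wf[of 1] by (auto simp: C_def link_def pair_wf_digraph_iff intro: rtrancl_into_rtrancl)
  have "h \<in> homs (\<Phi> 1) (\<Phi> 3)" unfolding h_def
  proof (rule restrict_homsI[OF wf])
    show "(if x \<in> C then edge 3 2 3 x else edge 3 0 1 x) \<in> pverts (\<Phi> 3)" if "x \<in> V" for x
      using homs_vert[OF edge_hom that, of 2 3 3] homs_vert[OF edge_hom that, of 0 1 3] by simp
    fix x y assume xy: "(x, y) \<in> parcs (\<Phi> 1)"
    then have V: "x \<in> V" "y \<in> V" using wf[of 1] by (auto simp: pair_wf_digraph_iff)
    show "(if x \<in> C then edge 3 2 3 x else edge 3 0 1 x, if y \<in> C then edge 3 2 3 y else edge 3 0 1 y)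
        \<in> parcs (\<Phi> 3)"
    proof (cases "(x, y) \<in> link")
      case True
      then have "(y, x) \<in> link" by (auto simp: link_def)
      with True closed have "x \<in> C \<longleftrightarrow> y \<in> C" by blast
      then show ?thesis using arcs[of 2 3, OF _ _ xy] arcs[of 0 1, OF _ _ xy] by simp
    next
      case False
      \<comment> \<open>An arc that is not a link has an end that depends on neither index, and
        there both formulas for \<open>h\<close> agree.\<close>
      then have "edge 3 2 3 x = edge 3 0 1 x \<or> edge 3 2 3 y = edge 3 0 1 y"
        using xy const V by (auto simp: link_def)
      then show ?thesis using arcs[of 2 3, OF _ _ xy] arcs[of 0 1, OF _ _ xy] by auto
    qed
  qed
  then obtain \<theta> where \<theta>: "\<theta> \<in> Hom Simplicial 1 3" and h: "h = \<Psi> 1 3 \<theta>"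
    using \<Psi>_bij[of 1 3] by (auto simp: bij_betw_def)
  have const_in_Hom: "mor 0 (\<lambda>_. i) \<in> Hom Simplicial 0 n" if "i \<le> n" for i n
    using that by (intro mor_in_Hom) simp_all
  have edge_const: "edge n i j (\<Psi> 0 1 (mor 0 (\<lambda>_. s)) a) = \<Psi> 0 n (mor 0 (\<lambda>_. if s = 0 then i else j)) a"
    if "i \<le> j" "j \<le> n" "s \<le> 1" "a \<in> pverts (\<Phi> 0)" for n i j s a
  proof -
    have "mor 0 (\<lambda>t. edge_map i j (mor 0 (\<lambda>_. s) t)) = mor 0 (\<lambda>_. if s = 0 then i else j)"
      using that(3) by (auto simp: fun_eq_iff)
    then show ?thesis
      using \<Psi>_compose[OF const_in_Hom edge_map_in_Hom that(4), of s i j n] that by (simp add: edge_def)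
  qed
  \<comment> \<open>The value \<open>\<theta> s\<close> is recovered from \<open>\<Phi> 0\<close>:
    by faithfulness, two maps \<open>[0] -> [3]\<close> are equal once they act equally on its
    vertices.\<close>
  have val: "\<theta> s = (if s = 0 then 2 else 1)" if s: "s \<le> 1" for s
  proof -
    have "\<Psi> 0 3 (mor 0 (\<lambda>_. \<theta> s)) a = \<Psi> 0 3 (mor 0 (\<lambda>_. if s = 0 then 2 else 1)) a" for a
    proof (cases "a \<in> pverts (\<Phi> 0)")
      case True
      let ?d = "\<Psi> 0 1 (mor 0 (\<lambda>_. s)) a"
      have d: "?d \<in> V" using homs_vert[OF \<Psi>_hom[OF const_in_Hom[OF s]] True] .
      have "\<Psi> 0 3 (mor 0 (\<lambda>_. \<theta> s)) a = h ?d"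
      proof -
        have "mor 0 (\<lambda>t. \<theta> (mor 0 (\<lambda>_. s) t)) = mor 0 (\<lambda>_. \<theta> s)" by (auto simp: fun_eq_iff)
        then show ?thesis using \<Psi>_compose[OF const_in_Hom[OF s] \<theta> True] by (simp add: h)
      qed
      \<comment> \<open>A vertex induced by the constant 0 does not depend on the second index, so
        it lies in \<open>C\<close> or depends on neither index. One induced by the constant 1
        depends on neither index or is kept out of \<open>C\<close> by
        \<open>no_path\<close>.\<close>
      also have "\<dots> = (if s = 0 then edge 3 2 3 ?d else edge 3 0 1 ?d)"
      proof (cases "s = 0")
        case True
        then have "\<not> dep_snd ?d" using edge_const[of 0 1 2 s a] edge_const[of 0 2 2 s a] s \<open>a \<in> pverts (\<Phi> 0)\<close>
          by (simp add: dep_snd_def)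
        then have "?d \<in> C \<or> edge 3 2 3 ?d = edge 3 0 1 ?d" using const d by (auto simp: C_def)
        with True d show ?thesis by (auto simp: h_def)
      next
        case False
        then have "\<not> dep_fst ?d" using edge_const[of 0 2 2 s a] edge_const[of 1 2 2 s a] s \<open>a \<in> pverts (\<Phi> 0)\<close>
          by (simp add: dep_fst_def)
        then have "?d \<notin> C \<or> edge 3 2 3 ?d = edge 3 0 1 ?d" using const d no_path by (auto simp: C_def)
        with False d show ?thesis by (auto simp: h_def)
      qed
      also have "\<dots> = \<Psi> 0 3 (mor 0 (\<lambda>_. if s = 0 then 2 else 1)) a"
        using edge_const[of 2 3 3 s a] edge_const[of 0 1 3 s a] s True by (cases "s = 0") simp_all
      finally show ?thesis .
    next
      case False
      have "\<theta> s \<le> 3" using \<theta> s by (auto simp: Simplicial_def)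
      then show ?thesis
        using homs_outside[OF \<Psi>_hom[OF const_in_Hom] False, of _ 3] by simp
    qed
    then have "\<Psi> 0 3 (mor 0 (\<lambda>_. \<theta> s)) = \<Psi> 0 3 (mor 0 (\<lambda>_. if s = 0 then 2 else 1))" by blast
    moreover have "\<theta> s \<le> 3" using \<theta> s by (auto simp: Simplicial_def)
    ultimately have "mor 0 (\<lambda>_. \<theta> s) = mor 0 (\<lambda>_. if s = 0 then 2 else 1)"
      using bij_betw_imp_inj_on[OF \<Psi>_bij[of 0 3]] const_in_Hom by (simp add: inj_on_eq_iff)
    from fun_cong[OF this, of 0] show ?thesis by simp
  qed
  have "\<theta> 0 \<le> \<theta> 1" using \<theta> by (auto simp: Simplicial_def monotone_on_def)
  with val[of 0] val[of 1] show False by simp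
qed

text \<open>On a shortest path, a vertex independent of the first index could serve as an earlier
  end and one independent of the second as a later start, so all vertices strictly between the ends
  depend on both. At a repeated vertex a detour could be cut out.\<close>

lemma ex_minimal_link_path:
  "\<exists>q w. (\<forall>t \<le> Suc q. w t \<in> V) \<and> inj_on w {..Suc q} \<and>
    (\<forall>t \<le> q. (w t, w (Suc t)) \<in> parcs (underlying_graph (\<Phi> 1))) \<and>
    (\<forall>t \<le> Suc q. (dep_fst (w t) \<longleftrightarrow> t \<le> q) \<and> (dep_snd (w t) \<longleftrightarrow> 0 < t))"
proof -
  define P where "P = (\<lambda>n. \<exists>x y. x \<in> V \<and> y \<in> V \<and> dep_fst x \<and> \<not> dep_snd x \<and> dep_snd y \<and>
    \<not> dep_fst y \<and> (x, y) \<in> link ^^ n)"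
  have "\<exists>n. P n"
    using ex_link_path rtrancl_imp_relpow unfolding P_def by metis
  define n where "n = (LEAST n. P n)"
  have "P n" unfolding n_def using \<open>\<exists>n. P n\<close> by (rule LeastI_ex)
  have least: "n \<le> k" if "P k" for k unfolding n_def using that by (rule Least_le)
  obtain w where ends: "w 0 \<in> V" "w n \<in> V" "dep_fst (w 0)" "\<not> dep_snd (w 0)" "dep_snd (w n)" "\<not> dep_fst (w n)"
    and w: "\<And>t. t < n \<Longrightarrow> (w t, w (Suc t)) \<in> link"
    using \<open>P n\<close> unfolding P_def relpow_fun_conv by blast
  have "n \<noteq> 0" using ends by metis
  then obtain q where n: "n = Suc q" by (cases n) auto
  have segment: "(w s, w t) \<in> link ^^ (t - s)" if "s \<le> t" "t \<le> n" for s t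
    unfolding relpow_fun_conv using that w by (intro exI[of _ "\<lambda>i. w (s + i)"]) simp
  have wf: "pair_wf_digraph (\<Phi> 1)"
    using digraphs[OF \<Phi>_in] by (auto simp: pair_digraph_iff pair_wf_digraph_iff)
  have V: "w t \<in> V" if "t \<le> n" for t
    using that ends(2) w[of t] wf by (cases "t = n") (auto simp: link_def pair_wf_digraph_iff)
  have dep: "dep_fst (w t) \<or> dep_snd (w t)" if "t \<le> n" for t
    using that ends(5) w[of t] by (cases "t = n") (auto simp: link_def)
  have "\<not> dep_fst (w t) \<Longrightarrow> n \<le> t" if "t \<le> n" for t
    using least[of t] segment[of 0 t] V[of 0] V[of t] dep[OF that] that ends unfolding P_def by auto
  moreover have "\<not> dep_snd (w t) \<Longrightarrow> n \<le> n - t" if "t \<le> n" for t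
    using least[of "n - t"] segment[of t n] V[of t] V[of n] dep[OF that] that ends unfolding P_def by auto
  ultimately have deps: "(dep_fst (w t) \<longleftrightarrow> t \<le> q) \<and> (dep_snd (w t) \<longleftrightarrow> 0 < t)" if "t \<le> n" for t
    using that ends(4,6) n by (cases "t = 0"; cases "t = n") fastforce+
  have "w s \<noteq> w t" if "s < t" "t \<le> n" for s t
  proof
    assume "w s = w t"
    then have "(w 0, w n) \<in> link ^^ s O link ^^ (n - t)"
      using segment[of 0 s] segment[of t n] that by auto
    then have "P (s + (n - t))" using ends unfolding P_def relpow_add by blast
    then show False using least that by fastforce
  qed
  then have "inj_on w {..n}" by (intro linorder_inj_onI) auto
  then show ?thesis using V deps w n by (intro exI[of _ q] exI[of _ w]) (auto simp: link_def)
qed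

text \<open>An edge of \<open>complete_graph M\<close> becomes two copies of \<open>w\<close> joined
  at their last vertices. These have \<open>2 * (q + 1)\<close> arcs together, hence
  \<open>p = 2 * q + 1\<close>, independent of \<open>M\<close>.\<close>

lemma ex_Sub_in_underlying_graph:
  "\<exists>p. \<forall>M. \<exists>n. iso_to_subgraph (Sub p (complete_graph M)) (underlying_graph (\<Phi> n))"
proof -
  obtain q w where V: "\<And>t. t \<le> Suc q \<Longrightarrow> w t \<in> V" and inj: "inj_on w {..Suc q}"
    and arcs: "\<And>t. t \<le> q \<Longrightarrow> (w t, w (Suc t)) \<in> parcs (underlying_graph (\<Phi> 1))"
    and dep_fst: "\<And>t. t \<le> Suc q \<Longrightarrow> dep_fst (w t) \<longleftrightarrow> t \<le> q"
    and dep_snd: "\<And>t. t \<le> Suc q \<Longrightarrow> dep_snd (w t) \<longleftrightarrow> 0 < t"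
    using ex_minimal_link_path by blast
  show ?thesis
  proof (rule exI[of _ "Suc (2 * q)"], rule allI)
    fix M :: nat
    \<comment> \<open>The images of the path \<open>w\<close> under \<open>edge n i j\<close> for \<open>i < N \<le> j < 2 * N\<close> form a subdivision of \<open>K\<^bsub>N,N\<^esub>\<close>; the edge
      \<open>{a, b}\<close> of \<open>K\<^bsub>M\<^esub>\<close> is routed from \<open>a\<close> to \<open>b\<close> through the private vertex \<open>j = code a b\<close>.\<close>
    define N where "N = M * M"
    define n where "n = N + N"
    \<comment> \<open>A subdivided edge climbs \<open>w\<close> to its last vertex, reached at
      \<open>t = q + 1\<close>, and then descends again.\<close>
    define pos where "pos = (\<lambda>t. min t (2 * q + 2 - t))"
    define code where "code = (\<lambda>a b. N + (a * M + b))"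
    \<comment> \<open>The second index at a branch vertex is immaterial because \<open>w 0\<close>
      does not depend on it; \<open>N\<close> is a common choice for all edges at
      \<open>a\<close>.\<close>
    define f where "f = (\<lambda>v. case v of Branch a \<Rightarrow> edge n a N (w 0)
      | Inner a b t \<Rightarrow> edge n (if t \<le> Suc q then a else b) (code a b) (w (pos t)))"
    have M: "a < N" if "a < M" for a using that by (simp add: N_def) (metis le_square less_le_trans)
    have code: "N \<le> code a b" "code a b < n" if "a < M" "b < M" for a b
    proof -
      have "a * M + b < Suc a * M" using that by simp
      also have "\<dots> \<le> M * M" using that by (intro mult_right_mono) simp_all
      finally show "N \<le> code a b" "code a b < n" by (simp_all add: code_def n_def N_def)
    qed
    have code_inj: "a = a' \<and> b = b'" if "code a b = code a' b'" "b < M" "b' < M" for a b a' b'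
    proof -
      have "a * M + b = a' * M + b'" using that by (simp add: code_def)
      then have "(a * M + b) div M = (a' * M + b') div M" "(a * M + b) mod M = (a' * M + b') mod M"
        by simp_all
      then show ?thesis using that by simp
    qed
    have n: "N \<le> n" by (simp add: n_def)
    have pos: "pos t \<le> Suc q" for t by (auto simp: pos_def)
    have f_path: "f (sub_path (Suc (2 * q)) a b t)
        = edge n (if t \<le> Suc q then a else b) (code a b) (w (pos t))"
      if "a < M" "b < M" "t \<le> 2 * q + 2" for a b t
    proof -
      have "edge n a' N (w 0) = edge n a' (code a b) (w 0)" if "a' < M" for a'
        using not_dep_snd[of "w 0" a' N "code a b" n] dep_snd[of 0] M[OF that] code[OF \<open>a < M\<close> \<open>b < M\<close>]
          V[of 0] n by simp
      then show ?thesis using that by (auto simp: f_def sub_path_def pos_def)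
    qed
    have f_arc: "(f (sub_path (Suc (2 * q)) a b t), f (sub_path (Suc (2 * q)) a b (Suc t)))
        \<in> parcs (underlying_graph (\<Phi> n))" if "a < M" "b < M" "t \<le> Suc (2 * q)" for a b t
    proof -
      have edge_arc: "(edge n i (code a b) x, edge n i (code a b) y) \<in> parcs (underlying_graph (\<Phi> n))"
        if "(x, y) \<in> parcs (underlying_graph (\<Phi> 1))" "i < M" for x y i
        using homs_arc[OF edge_hom[of i "code a b" n]] that code[OF \<open>a < M\<close> \<open>b < M\<close>] M[of i] by auto
      show ?thesis
      proof (cases "t \<le> q")
        case True
        then have "pos t = t" "pos (Suc t) = Suc t" by (auto simp: pos_def)
        then show ?thesis using True that arcs edge_arc by (simp add: f_path)
      next
        case False
        then have p: "pos t = Suc (pos (Suc t))" "pos (Suc t) \<le> q" using that by (auto simp: pos_def)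
        then have "(w (pos t), w (pos (Suc t))) \<in> parcs (underlying_graph (\<Phi> 1))"
          using arcs[of "pos (Suc t)"] by auto
        \<comment> \<open>The last vertex of \<open>w\<close> does not depend on the first index, so
          the switch from \<open>a\<close> to \<open>b\<close> at the turning point is
          invisible.\<close>
        moreover have "edge n a (code a b) (w (pos t)) = edge n b (code a b) (w (pos t))" if "t = Suc q"
          using not_dep_fst[of "w (pos t)" a "code a b" b n] dep_fst[of "pos t"] V[of "pos t"] that
            code[OF \<open>a < M\<close> \<open>b < M\<close>] M[OF \<open>a < M\<close>] M[OF \<open>b < M\<close>] by (simp add: pos_def)
        ultimately show ?thesis using False that edge_arc[of "w (pos t)" "w (pos (Suc t))" b]
          by (cases "t = Suc q") (simp_all add: f_path)
      qed
    qed
    let ?S = "Sub (Suc (2 * q)) (complete_graph M)"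
    \<comment> \<open>Branch vertices count as place 0 with the dummy endpoint \<open>b = a\<close>,
      so that one formula for \<open>f\<close> covers all vertices.\<close>
    define shape where "shape = (\<lambda>v a b t. a < M \<and> b < M \<and> t \<le> 2 * q + 1 \<and>
      f v = edge n (if t \<le> Suc q then a else b) (code a b) (w (pos t)) \<and>
      (v = Branch a \<and> t = 0 \<and> b = a \<or> v = Inner a b t \<and> a < b \<and> 0 < t))"
    have ex_shape: "\<exists>a b t. shape v a b t" if "v \<in> pverts ?S" for v
    proof (cases v)
      case (Branch a)
      then have "a < M" using that by (auto simp: Sub_def complete_graph_def)
      moreover from this have "f v = edge n a (code a a) (w 0)"
        using not_dep_snd[of "w 0" a N "code a a" n] dep_snd[of 0] M[of a] code[of a a] V[of 0] n Branch
        by (simp add: f_def)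
      ultimately have "shape v a a 0" using Branch by (simp add: shape_def pos_def)
      then show ?thesis by blast
    next
      case (Inner a b t)
      then have "a < M" "b < M" "a < b" "0 < t" "t \<le> 2 * q + 1"
        using that by (auto simp: Sub_def complete_graph_def)
      then have "shape v a b t" using Inner by (simp add: shape_def f_def)
      then show ?thesis by blast
    qed
    have "inj_on f (pverts ?S)"
    proof (rule inj_onI)
      fix v v' assume "v \<in> pverts ?S" "v' \<in> pverts ?S" and eq: "f v = f v'"
      then obtain a b t a' b' t' where "shape v a b t" "shape v' a' b' t'" using ex_shape by metis
      then have ab: "a < M" "b < M" "a' < M" "b' < M"
        and t: "t \<le> 2 * q + 1" "t' \<le> 2 * q + 1"
        and fv: "f v = edge n (if t \<le> Suc q then a else b) (code a b) (w (pos t))"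
          "f v' = edge n (if t' \<le> Suc q then a' else b') (code a' b') (w (pos t'))"
        and v: "v = Branch a \<and> t = 0 \<and> b = a \<or> v = Inner a b t \<and> a < b \<and> 0 < t"
        and v': "v' = Branch a' \<and> t' = 0 \<and> b' = a' \<or> v' = Inner a' b' t' \<and> a' < b' \<and> 0 < t'"
        unfolding shape_def by simp_all
      define i where "i = (if t \<le> Suc q then a else b)"
      define i' where "i' = (if t' \<le> Suc q then a' else b')"
      have i: "i < N" "i' < N" using ab M by (auto simp: i_def i'_def)
      have eq: "edge n i (code a b) (w (pos t)) = edge n i' (code a' b') (w (pos t'))"
        using eq fv by (simp add: i_def i'_def)
      note cd = code[OF ab(1,2)] code[OF ab(3,4)]
      note E = edge_eq_imp[OF eq i cd(1) cd(3) less_imp_le[OF cd(2)] less_imp_le[OF cd(4)] V[OF pos] V[OF pos]]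
      have pos_eq: "pos t = pos t'" using inj_onD[OF inj E(1)] pos by simp
      have fst: "i = i'" if "pos t \<le> q" using E(2) dep_fst[OF pos] that by simp
      have snd: "a = a' \<and> b = b'" if "0 < pos t" 
        using code_inj[OF E(3) ab(2,4)] dep_snd[OF pos] that by simp
      show "v = v'"
      proof (cases "pos t = 0")
        case True
        then have "t = 0" "t' = 0" using pos_eq t by (auto simp: pos_def)
        then show ?thesis using fst True v v' by (auto simp: i_def i'_def)
      next
        case False
        then have "a = a'" "b = b'" using snd by auto
        have "0 < t" "0 < t'" using False pos_eq by (auto simp: pos_def intro: gr0I)
        then have "a < b" using v by auto
        have "t = t'"
        proof (rule ccontr)
          assume "t \<noteq> t'"
          \<comment> \<open>Only mirror places \<open>t\<close> and \<open>2 * q + 2 - t\<close>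
            share a value of \<open>pos\<close>. They lie on different halves, whose first indices
            are \<open>a\<close> and \<open>b\<close>.\<close>
          then have "pos t \<le> q" and "(t \<le> Suc q) \<noteq> (t' \<le> Suc q)"
            using pos_eq t unfolding pos_def by linarith+
          then show False
            using fst \<open>a = a'\<close> \<open>b = b'\<close> \<open>a < b\<close> by (cases "t \<le> Suc q") (simp_all add: i_def i'_def)
        qed
        then show ?thesis using v v' \<open>0 < t\<close> \<open>a = a'\<close> \<open>b = b'\<close> by auto
      qed
    qed
    moreover have "f ` pverts ?S \<subseteq> pverts (underlying_graph (\<Phi> n))"
    proof (rule image_subsetI)
      fix v assume "v \<in> pverts ?S"
      then obtain a b t where "shape v a b t" using ex_shape by blast
      then have "a < M" "b < M"
        and "f v = edge n (if t \<le> Suc q then a else b) (code a b) (w (pos t))"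
        unfolding shape_def by simp_all
      moreover from this have "(if t \<le> Suc q then a else b) \<le> code a b" "code a b \<le> n"
        using code[of a b] M[of a] M[of b] by simp_all
      ultimately show "f v \<in> pverts (underlying_graph (\<Phi> n))"
        using homs_vert[OF edge_hom V[OF pos[of t]]] by simp
    qed
    moreover have "(f x, f y) \<in> parcs (underlying_graph (\<Phi> n))" if arc: "(x, y) \<in> parcs ?S" for x y
    proof -
      obtain a b t where "(a, b) \<in> parcs (complete_graph M)" "t \<le> Suc (2 * q)"
        and xy: "x = sub_path (Suc (2 * q)) a b t \<and> y = sub_path (Suc (2 * q)) a b (Suc t) \<or>
          y = sub_path (Suc (2 * q)) a b t \<and> x = sub_path (Suc (2 * q)) a b (Suc t)"
        using arc unfolding Sub_arcs_iff by blast
      then have f_arc: "(f (sub_path (Suc (2 * q)) a b t), f (sub_path (Suc (2 * q)) a b (Suc t)))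
          \<in> parcs (underlying_graph (\<Phi> n))"
        using f_arc by (simp add: complete_graph_def)
      from xy show ?thesis
      proof
        assume "x = sub_path (Suc (2 * q)) a b t \<and> y = sub_path (Suc (2 * q)) a b (Suc t)"
        then show ?thesis using f_arc by simp
      next
        assume "y = sub_path (Suc (2 * q)) a b t \<and> x = sub_path (Suc (2 * q)) a b (Suc t)"
        then show ?thesis using f_arc by auto
      qed
    qed
    ultimately have "graph_embedding ?S (underlying_graph (\<Phi> n)) f"
      unfolding graph_embedding_def by blast
    moreover have "pair_wf_digraph (underlying_graph (\<Phi> n))"
      using digraphs[OF \<Phi>_in] by (intro pair_graph_imp_wf pair_graph_underlying_graph)
    ultimately show "\<exists>n. iso_to_subgraph ?S (underlying_graph (\<Phi> n))"
      using iso_to_subgraph_iff[OF pair_wf_digraph_Sub[OF pair_wf_digraph_complete_graph]] by blast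
  qed
qed

end

section \<open>The implications between the three statements\<close>

lemma embeds_Simplicial_imp_somewhere_dense:
  assumes "graph_class \<K>" "oriented_graph_class \<D>" "\<forall>D \<in> \<D>. \<exists>G \<in> \<K>. orientation_of D G"
    and "embeds (full_subcategory OGra \<D>) Simplicial"
  shows "somewhere_dense \<K>"
proof -
  obtain \<Phi> \<Psi> where "fully_faithful_functor Simplicial (graph_category \<D>) \<Phi> \<Psi>"
    using assms(4) by (auto simp: embeds_def full_subcategory_OGra)
  moreover have digraphs: "pair_digraph D" if "D \<in> \<D>" for D
    using assms(2) that
    by (auto simp: oriented_graph_class_def OGra_def graph_category_def oriented_graph_def subset_iff)
  ultimately interpret embedded_Simplicial \<D> \<Phi> \<Psi>
    by (intro embedded_Simplicial.intro embedded_Simplicial_axioms.intro)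
  have "underlying_graph (\<Phi> n) \<in> \<K>" for n
  proof -
    obtain G where "G \<in> \<K>" "orientation_of (\<Phi> n) G" using assms(3) \<Phi>_in by blast
    moreover from this have "pair_graph G"
      using assms(1) unfolding graph_class_def Gra_def graph_category_def by auto
    ultimately show ?thesis by (simp add: orientation_of_imp_underlying_graph)
  qed
  then have "\<exists>p. \<forall>M. \<exists>G \<in> \<K>. iso_to_subgraph (Sub p (complete_graph M)) G"
    using ex_Sub_in_underlying_graph by blast
  then show ?thesis by (simp add: somewhere_dense_def nowhere_dense_def)
qed

lemma oriented_graph_wf:
  assumes "oriented_graph D"
  shows "pair_wf_digraph D" "finite (pverts D)"
  using assms by (auto simp: oriented_graph_def pair_digraph_iff pair_wf_digraph_iff)

theorem theorem1:
  fixes \<K> :: "ngraph set"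
  assumes "graph_class \<K>" and "monotone_class \<K>"
  shows "((\<exists>\<D>. oriented_graph_class \<D> \<and> (\<forall>D \<in> \<D>. \<exists>G \<in> \<K>. orientation_of D G) \<and>
              embeds (full_subcategory OGra \<D>) OGra)
          \<longleftrightarrow> (\<exists>\<D>. oriented_graph_class \<D> \<and> (\<forall>D \<in> \<D>. \<exists>G \<in> \<K>. orientation_of D G) \<and>
              embeds (full_subcategory OGra \<D>) Simplicial))
       \<and> ((\<exists>\<D>. oriented_graph_class \<D> \<and> (\<forall>D \<in> \<D>. \<exists>G \<in> \<K>. orientation_of D G) \<and>
              embeds (full_subcategory OGra \<D>) Simplicial)
          \<longleftrightarrow> somewhere_dense \<K>)"
    (is "(?OGra \<longleftrightarrow> ?Simplicial) \<and> _")
proof -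
  have order_graph: "pair_wf_digraph (order_graph n)" "finite (pverts (order_graph n))" for n
    by (auto simp: order_graph_def pair_wf_digraph_iff)
  \<comment> \<open>Already for \<open>l = 1\<close> the encoding of an ordinal is an oriented
    graph. Composing with this embedding turns an embedding of \<open>OGra\<close> into one of
    \<open>Simplicial\<close>.\<close>
  have "embeds OGra Simplicial"
    using embeds_Simplicial[of 1 "{D. oriented_graph D}"] oriented_graph_path_graph[of 1] order_graph
    by (simp add: OGra_def)
  then have 12: "?OGra \<Longrightarrow> ?Simplicial" using embeds_trans by blast
  have 23: "?Simplicial \<Longrightarrow> somewhere_dense \<K>"
    using embeds_Simplicial_imp_somewhere_dense[OF assms(1)] by blast
  have 31: "?OGra" if dense: "somewhere_dense \<K>"
  proof -
    obtain l where l: "0 < l"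
      "\<And>R. pair_wf_digraph R \<Longrightarrow> finite (pverts R) \<Longrightarrow> path_graph l R \<in> orientations \<K>"
      using somewhere_dense_imp_orientations[OF assms dense] by blast
    have "embeds (graph_category (orientations \<K>)) OGra"
      using l by (intro embeds_OGra[of l]) (auto simp: orientations_def oriented_graph_wf)
    moreover have "\<forall>D \<in> orientations \<K>. \<exists>G \<in> \<K>. orientation_of D G"
      using orientation_of_underlying_graph by (auto simp: orientations_def)
    ultimately show ?thesis
      using oriented_graph_class_orientations[OF assms(1)] by (auto simp: full_subcategory_OGra)
  qed
  from 12 23 31 show ?thesis by blast
qed

end
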